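(* Let $f^*$ be an optimal threshold curve in the memoryless best-choice problem, i.e. a threshold curve with $J(f^* )=\sup_f J(f)$, where the supremum is over all threshold curves, let $\tau^*$ be the associated memoryless stopping rule and $F^*(t)=\int_0^t f^*(s)\,ds$. Then, as $t\to1$, $$f^*(t)\sim-\log(1-t),$$ i.e. the ratio of the two sides tends to $1$. Consequently $f^*$ is integrable on $[0,1)$, that is $F^*(1)<\infty$, and $\mathbb P[\tau^*=1]=e^{-F^*(1)}>0$.
   Context: Let $\Pi$ be a Poisson point process of unit rate in $[0,1]\times[0,\infty)$; an atom $(t,x)$ is a score $x$ observed at time $t$. Let $(T,M)$ denote the (a.s. unique) atom of $\Pi$ with the smallest score. A threshold curve is a nondecreasing càdlàg function $f:[0,1)\to[0,\infty)$. The associated memoryless stopping point $(\tau,\xi)$ is the atom of $\Pi$ with the smallest arrival time in the subgraph $\{(t,x): x\le f(t)\}$, with $(\tau,\xi)=(1,\infty)$ if there is no such atom. Set $J(f):=\mathbb P[\tau=T]$. *)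

theory Defs
  imports "HOL-Probability.Probability"
begin

definition strip :: "(real \<times> real) set" where
  "strip = {0..1} \<times> {0..}"

text \<open>
  The intensity measure has no atoms, so the process is simple and is represented by its random
  set of atoms. As usual for point processes, every realisation is a locally finite configuration.
  Counts are prescribed on bounded Borel sets, where they are finite. The Poisson probabilities are
  written out because the library's \<open>poisson_pmf\<close> is specified for positive rates only, whereas
  null sets have rate 0.
\<close>

locale unit_rate_poisson_process = prob_space M for M :: "'w measure" +
  fixes N :: "'w \<Rightarrow> (real \<times> real) set"
  assumes atoms_in_strip: "\<omega> \<in> space M \<Longrightarrow> N \<omega> \<subseteq> strip"
    and locally_finite: "\<omega> \<in> space M \<Longrightarrow> bounded B \<Longrightarrow> finite (N \<omega> \<inter> B)"
    and count_measurable: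
      "B \<in> sets borel \<Longrightarrow> bounded B \<Longrightarrow> B \<subseteq> strip \<Longrightarrow>
        (\<lambda>\<omega>. card (N \<omega> \<inter> B)) \<in> M \<rightarrow>\<^sub>M count_space UNIV"
    and count_poisson:
      "B \<in> sets borel \<Longrightarrow> bounded B \<Longrightarrow> B \<subseteq> strip \<Longrightarrow>
        prob {\<omega> \<in> space M. card (N \<omega> \<inter> B) = k} =
          measure lborel B ^ k / fact k * exp (- measure lborel B)"
    and count_indep:
      "finite I \<Longrightarrow> disjoint_family_on A I \<Longrightarrow>
        (\<And>i. i \<in> I \<Longrightarrow> A i \<in> sets borel \<and> bounded (A i) \<and> A i \<subseteq> strip) \<Longrightarrow>
        indep_vars (\<lambda>_. count_space UNIV) (\<lambda>i \<omega>. card (N \<omega> \<inter> A i)) (I :: nat set)"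

text \<open>
  Only the values of \<open>f\<close> on \<open>[0,1)\<close> matter.
\<close>

definition threshold_curve :: "(real \<Rightarrow> real) \<Rightarrow> bool" where
  "threshold_curve f \<longleftrightarrow>
     (\<forall>t\<in>{0..<1}. 0 \<le> f t) \<and>
     mono_on {0..<1} f \<and>
     (\<forall>t\<in>{0..<1}. (f \<longlongrightarrow> f t) (at_right t)) \<and>
     (\<forall>t\<in>{0<..<1}. \<exists>l. (f \<longlongrightarrow> l) (at_left t))"

definition subgraph :: "(real \<Rightarrow> real) \<Rightarrow> (real \<times> real) set" where
  "subgraph f = {(t, x). 0 \<le> t \<and> t < 1 \<and> 0 \<le> x \<and> x \<le> f t}"

text \<open>
  The atom of \<open>A\<close> with the smallest key (arrival time or score), and \<open>(1, \<infinity>)\<close> if there is none.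
  The value \<open>(1, \<infinity>)\<close> also covers the case of ties, which almost surely do not occur in the
  Poisson process; a fixed value there, rather than an arbitrary choice among the tied atoms,
  keeps the random variables below measurable without completing the probability space.
\<close>

definition min_atom :: "(real \<times> real \<Rightarrow> real) \<Rightarrow> (real \<times> real) set \<Rightarrow> real \<times> ereal" where
  "min_atom key A =
     (if \<exists>!p. is_arg_min key (\<lambda>q. q \<in> A) p
      then (case (THE p. is_arg_min key (\<lambda>q. q \<in> A) p) of (t, x) \<Rightarrow> (t, ereal x))
      else (1, \<infinity>))"

definition best_atom :: "(real \<times> real) set \<Rightarrow> real \<times> ereal" where
  "best_atom A = min_atom snd A"

definition memoryless_point :: "(real \<Rightarrow> real) \<Rightarrow> (real \<times> real) set \<Rightarrow> real \<times> ereal" where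
  "memoryless_point f A = min_atom fst (A \<inter> subgraph f)"

definition best_time :: "(real \<times> real) set \<Rightarrow> real" where
  "best_time A = fst (best_atom A)"

definition memoryless_time :: "(real \<Rightarrow> real) \<Rightarrow> (real \<times> real) set \<Rightarrow> real" where
  "memoryless_time f A = fst (memoryless_point f A)"

definition success_prob :: "'w measure \<Rightarrow> ('w \<Rightarrow> (real \<times> real) set) \<Rightarrow> (real \<Rightarrow> real) \<Rightarrow> real" where
  "success_prob M N f = measure M {\<omega> \<in> space M. memoryless_time f (N \<omega>) = best_time (N \<omega>)}"

definition optimal_threshold_curve ::
    "'w measure \<Rightarrow> ('w \<Rightarrow> (real \<times> real) set) \<Rightarrow> (real \<Rightarrow> real) \<Rightarrow> bool" where
  "optimal_threshold_curve M N f \<longleftrightarrow>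
     threshold_curve f \<and>
     success_prob M N f = (SUP g\<in>{g. threshold_curve g}. success_prob M N g)"

definition cumulative :: "(real \<Rightarrow> real) \<Rightarrow> real \<Rightarrow> ennreal" where
  "cumulative f t = (\<integral>\<^sup>+s\<in>{0..<t}. ennreal (f s) \<partial>lborel)"

end

theory Submission
  imports Defs "HOL-Real_Asymp.Real_Asymp"
begin

text \<open>
  Writing \<open>A f t x = (\<integral>s\<in>{0..t}. max (f s) x) + (1 - t) x\<close> for the area that must be free of atoms if an
  atom \<open>(t, x)\<close> is to be both the first one below \<open>f\<close> and the best one overall, the Mecke formula gives
  \<open>J f = \<integral>t\<in>{0..<1}. \<integral>x\<in>{0..f t}. exp (- A f t x)\<close>. An optimal \<open>f\<close> is compared with two monotone modifications.
  Raising \<open>f\<close> to at least \<open>c\<close> from time \<open>t0\<close> on would pay off if \<open>f t0 < c\<close> and \<open>c e^c (1 - t0) \<le> 1/2\<close>: a success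
  after the new stopping point needs an atom in a rectangle of area at most \<open>c (1 - t0)\<close>, whereas stopping
  succeeds with probability at least \<open>e^(-c)\<close>. Capping \<open>f\<close> by \<open>h = (1 + \<delta>) (- ln (1 - t)) + K\<close>, with \<open>K\<close> large,
  would pay off if \<open>f\<close> exceeded \<open>h\<close> anywhere: stopping above \<open>h\<close> succeeds with probability at most of order
  \<open>(1 - t) e^(- K T)\<close> with \<open>T\<close> close to 1, whereas continuing below the integrable \<open>h\<close> succeeds with probability
  at least of order \<open>(1 - t) e^(- K (1 - T))\<close>. The two bounds give the asymptotics and integrability.
\<close>

subsection \<open>Minimal atoms and threshold curves\<close>

text \<open>No equation for the optimum is solved: optimality enters only through two competitors,
  and each comparison reduces to a single number. Moving the curve by \<phi> changes the integrand
  at time u through the integral of \<phi> up to u, and exchanging the order of integration leaves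
  the weight 1 - s on \<phi>(s). For the raise this weight is at most 1 - t0 and supplies the
  smallness. For the cap it works against the argument: the gain carries 1 - s, so the loss must
  carry it too. Hence the logarithm: an atom above h at time s wins only if a rectangle of width T
  and height h(s) is empty, and (1 + \<delta>) T \<ge> 1 turns this into a factor (1 - s) e^(- K T).
  The area below h after T is at most 1 + \<delta> + K (1 - T), since - ln (1 - t) integrates to 1.
  With T \<ge> 3/4 the two exponents differ by at least K / 2, which outweighs the remaining
  constants for large K. A priori f need not be integrable and its subgraph may have infinite area;
  hence the integrals in ennreal, with finiteness obtained before anything is cancelled.\<close>

lemma min_atom_eq:
  assumes "p \<in> A" "\<And>q. q \<in> A \<Longrightarrow> q \<noteq> p \<Longrightarrow> key p < key q"
  shows "min_atom key A = (fst p, ereal (snd p))"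
proof -
  have "is_arg_min key (\<lambda>q. q \<in> A) = (\<lambda>q. q = p)"
    using assms unfolding is_arg_min_def by (metis less_asym)
  then show ?thesis
    unfolding min_atom_def by (simp add: case_prod_unfold)
qed

text \<open>Uniqueness of the minimiser and strict minimality coincide, because an atom that ties
  with a minimiser is itself one; ties therefore fall under the default value.\<close>

lemma min_atom_none:
  assumes "\<not> (\<exists>p\<in>A. \<forall>q\<in>A. q \<noteq> p \<longrightarrow> key p < key q)"
  shows "min_atom key A = (1, \<infinity>)"
proof -
  have "\<not> (\<exists>!p. is_arg_min key (\<lambda>q. q \<in> A) p)"
  proof
    assume "\<exists>!p. is_arg_min key (\<lambda>q. q \<in> A) p"
    then obtain p where p: "is_arg_min key (\<lambda>q. q \<in> A) p"
      and u: "\<And>q. is_arg_min key (\<lambda>q. q \<in> A) q \<Longrightarrow> q = p" by blast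
    have "key p < key q" if "q \<in> A" "q \<noteq> p" for q
    proof (rule ccontr)
      assume "\<not> key p < key q"
      then have "is_arg_min key (\<lambda>q. q \<in> A) q"
        using p that(1) unfolding is_arg_min_def by force
      then show False using u that by blast
    qed
    then show False using assms p unfolding is_arg_min_def by blast
  qed
  then show ?thesis unfolding min_atom_def by (rule if_not_P)
qed

text \<open>Levels are restricted to \<open>U\<close> because finiteness may fail elsewhere: scores
  allow every level, but below a curve that is unbounded near time 1 only the levels below 1 are
  known to hold finitely many atoms.\<close>

lemma ex_min_on_levels:
  fixes key :: "'a \<Rightarrow> real"
  assumes "\<And>r. r \<in> U \<Longrightarrow> finite {q \<in> A. key q \<le> r}" "key ` A \<subseteq> U" "A \<noteq> {}"
  shows "\<exists>p\<in>A. \<forall>q\<in>A. key p \<le> key q"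
proof -
  from assms(3) obtain a where a: "a \<in> A" by blast
  let ?B = "{q \<in> A. key q \<le> key a}"
  have "finite ?B" "?B \<noteq> {}" using assms a by auto
  then obtain p where "is_arg_min key (\<lambda>q. q \<in> ?B) p"
    using ex_is_arg_min_if_finite by blast
  then show ?thesis unfolding is_arg_min_def by (metis (mono_tags, lifting) linorder_le_less_linear mem_Collect_eq order_le_less_trans order_less_le)
qed

text \<open>Strict minimality becomes a statement on countably many levels: any level between the
  smallest and the second smallest key isolates the minimiser. \<open>U\<close> is open so that a
  rational level of this kind exists inside it.\<close>

lemma strict_min_iff_level:
  fixes key :: "'a \<Rightarrow> real"
  assumes fin: "\<And>r. r \<in> U \<Longrightarrow> finite {q \<in> A. key q \<le> r}"
    and U: "open U" "key ` A \<subseteq> U"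
  shows "(p \<in> A \<and> (\<forall>q\<in>A. q \<noteq> p \<longrightarrow> key p < key q)) \<longleftrightarrow> (\<exists>r\<in>U \<inter> \<rat>. {q \<in> A. key q \<le> r} = {p})"
proof
  assume p: "p \<in> A \<and> (\<forall>q\<in>A. q \<noteq> p \<longrightarrow> key p < key q)"
  then have "key p \<in> U" using U by blast
  then obtain e where e: "e > 0" "ball (key p) e \<subseteq> U"
    using U(1) open_contains_ball by blast
  define r0 where "r0 = key p + e / 2"
  have "r0 \<in> U" using e by (auto simp: r0_def dist_real_def intro!: subsetD[OF e(2)])
  then have finB: "finite (insert r0 (key ` ({q \<in> A. key q \<le> r0} - {p})))"
    using fin by auto
  \<comment> \<open>The second smallest key, cut off at \<open>r0\<close> so that only finitely many
    atoms enter the minimum.\<close>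
  define m where "m = Min (insert r0 (key ` ({q \<in> A. key q \<le> r0} - {p})))"
  have m: "m \<le> r0" "\<And>q. q \<in> A \<Longrightarrow> q \<noteq> p \<Longrightarrow> m \<le> key q"
  proof -
    show "m \<le> r0" unfolding m_def using finB by (intro Min_le) auto
    show "m \<le> key q" if "q \<in> A" "q \<noteq> p" for q
      using Min_le[OF finB, of "key q"] Min_le[OF finB, of r0] that by (cases "key q \<le> r0") (auto simp: m_def)
  qed
  have "key p < m" unfolding m_def using finB p e by (subst Min_gr_iff) (auto simp: r0_def)
  then obtain r where r: "r \<in> \<rat>" "key p < r" "r < m" using Rats_dense_in_real by blast
  have "r \<in> U" using r m(1) e by (auto simp: r0_def dist_real_def intro!: subsetD[OF e(2)])
  moreover have "{q \<in> A. key q \<le> r} = {p}" using p r m(2) by force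
  ultimately show "\<exists>r\<in>U \<inter> \<rat>. {q \<in> A. key q \<le> r} = {p}" using r by blast
next
  assume "\<exists>r\<in>U \<inter> \<rat>. {q \<in> A. key q \<le> r} = {p}"
  then obtain r where r: "{q \<in> A. key q \<le> r} = {p}" by blast
  then have p: "p \<in> A" "key p \<le> r" by auto
  have "key p < key q" if "q \<in> A" "q \<noteq> p" for q
  proof -
    have "\<not> key q \<le> r" using r that by blast
    then show ?thesis using p by simp
  qed
  then show "p \<in> A \<and> (\<forall>q\<in>A. q \<noteq> p \<longrightarrow> key p < key q)" using p by blast
qed

text \<open>The process is accessible only through counts of atoms in fixed sets, so measurability
  requires the minimal atom to be expressed by counts: one atom up to level r, and one among these
  that arrives by time a. The condition a < 1 keeps the default time 1 out of the event.\<close>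

lemma min_atom_time_le_iff:
  fixes A :: "(real \<times> real) set"
  assumes fin: "\<And>r. r \<in> U \<Longrightarrow> finite {q \<in> A. key q \<le> r}"
    and U: "open U" "key ` A \<subseteq> U" and a: "a < 1"
  shows "fst (min_atom key A) \<le> a \<longleftrightarrow>
    (\<exists>r\<in>U \<inter> \<rat>. card {q \<in> A. key q \<le> r} = 1 \<and> card {q \<in> A. key q \<le> r \<and> fst q \<le> a} = 1)"
    (is "_ \<longleftrightarrow> ?R")
proof -
  note lev = strict_min_iff_level[where key = key, OF fin U]
  show ?thesis
  proof (cases "\<exists>p\<in>A. \<forall>q\<in>A. q \<noteq> p \<longrightarrow> key p < key q")
    case True
    then obtain p where p: "p \<in> A" "\<And>q. q \<in> A \<Longrightarrow> q \<noteq> p \<Longrightarrow> key p < key q" by blast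
    have m: "fst (min_atom key A) = fst p" using min_atom_eq[where key = key, OF p] by simp
    have "?R \<longleftrightarrow> fst p \<le> a"
    proof
      assume ?R
      then obtain r where r: "r \<in> U \<inter> \<rat>" "card {q \<in> A. key q \<le> r} = 1"
        "card {q \<in> A. key q \<le> r \<and> fst q \<le> a} = 1" by blast
      then obtain p' where p': "{q \<in> A. key q \<le> r} = {p'}" by (auto simp: card_1_singleton_iff)
      then have "p' \<in> A \<and> (\<forall>q\<in>A. q \<noteq> p' \<longrightarrow> key p' < key q)" using lev r by blast
      then have "p' = p" using p by (metis less_asym)
      moreover have "{q \<in> A. key q \<le> r \<and> fst q \<le> a} \<noteq> {}" using r(3) by (metis card.empty zero_neq_one)
      then obtain q where "q \<in> A" "key q \<le> r" "fst q \<le> a" by blast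
      moreover from this have "q = p'" using p' by blast
      ultimately show "fst p \<le> a" by simp
    next
      assume le: "fst p \<le> a"
      obtain r where r: "r \<in> U \<inter> \<rat>" "{q \<in> A. key q \<le> r} = {p}" using lev p by blast
      then have "{q \<in> A. key q \<le> r \<and> fst q \<le> a} = {p}" using le by blast
      with r show ?R by (intro bexI[of _ r]) simp_all
    qed
    then show ?thesis using m by simp
  next
    case False
    have "\<not> ?R"
    proof
      assume ?R
      then obtain r p where "r \<in> U \<inter> \<rat>" "{q \<in> A. key q \<le> r} = {p}" by (auto simp: card_1_singleton_iff)
      then have "p \<in> A \<and> (\<forall>q\<in>A. q \<noteq> p \<longrightarrow> key p < key q)" using lev by blast
      then show False using False by blast
    qed
    then show ?thesis using min_atom_none[OF False] a by simp
  qed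
qed

text \<open>Ties aside, an atom of the subgraph is both the first one there and the best overall iff
  its blocking region contains no atom. The strict inequalities leave \<open>p\<close> itself
  outside and make the region monotone in both coordinates of \<open>p\<close>.\<close>

definition blocking :: "(real \<Rightarrow> real) \<Rightarrow> real \<times> real \<Rightarrow> (real \<times> real) set" where
  "blocking f p = {q \<in> strip. fst q < fst p \<and> q \<in> subgraph f \<or> snd q < snd p}"

lemma subgraph_time: "p \<in> subgraph f \<Longrightarrow> fst p < 1"
  by (auto simp: subgraph_def)

lemma subgraph_strip: "subgraph f \<subseteq> strip"
  by (auto simp: subgraph_def strip_def)

lemma sets_strip[measurable]: "strip \<in> sets borel"
  unfolding strip_def by (intro borel_closed closed_Times closed_atLeastAtMost closed_atLeast)

locale curve =
  fixes f :: "real \<Rightarrow> real"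
  assumes nonneg: "0 \<le> t \<Longrightarrow> t < 1 \<Longrightarrow> 0 \<le> f t"
    and mono: "0 \<le> s \<Longrightarrow> s \<le> t \<Longrightarrow> t < 1 \<Longrightarrow> f s \<le> f t"

lemma threshold_curve_imp_curve: "threshold_curve f \<Longrightarrow> curve f"
  unfolding threshold_curve_def curve_def by (auto simp: mono_on_def)

context curve
begin

text \<open>The values outside [0,1) are arbitrary and possibly not measurable, so they are replaced
  by 0.\<close>

lemma measurable_restrict:
  "(\<lambda>t. indicator {0..<1} t * f t) \<in> borel_measurable borel"
proof -
  have "mono_on {0..<1} f" by (intro mono_onI) (auto intro: mono)
  then have "f \<in> borel_measurable (restrict_space borel {0..<1})"
    by (intro borel_measurable_mono_on_fnc)
  then show ?thesis
    by (subst (asm) borel_measurable_restrict_space_iff) (auto)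
qed

lemma sets_subgraph[measurable]: "subgraph f \<in> sets borel"
proof -
  note measurable_restrict[measurable]
  have "subgraph f = {p \<in> space borel. 0 \<le> fst p \<and> fst p < 1 \<and> 0 \<le> snd p \<and>
      snd p \<le> indicator {0..<1} (fst p) * f (fst p)}"
    by (auto simp: subgraph_def)
  also have "\<dots> \<in> sets borel"
    unfolding borel_prod[symmetric] by measurable
  finally show ?thesis .
qed

lemma sets_blocking[measurable]: "blocking f p \<in> sets borel"
proof -
  have "blocking f p = strip \<inter> ((fst -` {..<fst p} \<inter> subgraph f) \<union> snd -` {..<snd p})"
    by (auto simp: blocking_def)
  moreover have "fst -` {..<fst p} \<in> sets (borel :: (real \<times> real) measure)"
    using borel_open[OF open_vimage_fst[OF open_lessThan]] by (metis vimage_def)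
  moreover have "snd -` {..<snd p} \<in> sets (borel :: (real \<times> real) measure)"
    using borel_open[OF open_vimage_snd[OF open_lessThan]] by (metis vimage_def)
  ultimately show ?thesis by auto
qed

lemma bounded_subgraph: "r < 1 \<Longrightarrow> bounded {q \<in> subgraph f. fst q \<le> r}"
  by (rule bounded_subset[where T = "{0..1} \<times> {0..f r}"])
     (auto simp: subgraph_def intro!: bounded_Times intro: order_trans[OF _ mono])

lemma bounded_blocking:
  assumes "fst p < 1"
  shows "bounded (blocking f p)"
  by (rule bounded_subset[where T = "{q \<in> subgraph f. fst q \<le> fst p} \<union> {0..1} \<times> {0..snd p}"])
     (auto simp: blocking_def strip_def intro!: bounded_Times bounded_subgraph[OF assms])

end

subsection \<open>The Poisson process\<close>

lemma poisson_mean: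
  fixes a :: real
  assumes "0 \<le> a"
  shows "(\<Sum>k. ennreal (real k * (a ^ k / fact k * exp (- a)))) = ennreal a"
proof -
  have "(\<lambda>k. a ^ k / fact k) sums exp a"
    using exp_converges[of a] by (simp add: divide_inverse_commute)
  then have "(\<lambda>k. a * exp (- a) * (a ^ k / fact k)) sums (a * exp (- a) * exp a)"
    by (rule sums_mult)
  then have "(\<lambda>k. real (Suc k) * (a ^ Suc k / fact (Suc k) * exp (- a))) sums a"
    by (simp add: exp_minus field_simps del: of_nat_Suc)
  then have "(\<lambda>k. real k * (a ^ k / fact k * exp (- a))) sums a"
    by (subst (asm) sums_Suc_iff) simp
  then show ?thesis
    using assms by (intro sums_unique[symmetric], subst sums_ennreal) auto
qed

text \<open>The bound is quadratic, so a sum over n sets of area of order 1/n still tends to 0; this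
  is how ties are excluded.\<close>

lemma poisson_two_or_more:
  fixes a :: real
  assumes "0 \<le> a"
  shows "1 - exp (- a) - a * exp (- a) \<le> a\<^sup>2"
proof -
  have "(1 + a) * (1 - a) \<le> (1 + a) * exp (- a)"
    using exp_ge_add_one_self[of "- a"] assms by (intro mult_left_mono) auto
  then show ?thesis by (simp add: algebra_simps power2_eq_square)
qed

context unit_rate_poisson_process
begin

lemma count_sets[measurable]:
  assumes "B \<in> sets borel" "bounded B" "B \<subseteq> strip"
  shows "{\<omega> \<in> space M. P (card (N \<omega> \<inter> B))} \<in> events"
  using measurable_sets[OF count_measurable[OF assms], of "{k. P k}"]
  by (simp add: vimage_def Int_def conj_commute)

lemma count_avoid:
  assumes "B \<in> sets borel" "bounded B" "B \<subseteq> strip"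
  shows "{\<omega> \<in> space M. N \<omega> \<inter> B = {}} \<in> events"
    and "prob {\<omega> \<in> space M. N \<omega> \<inter> B = {}} = exp (- measure lborel B)"
proof -
  have "{\<omega> \<in> space M. N \<omega> \<inter> B = {}} = {\<omega> \<in> space M. card (N \<omega> \<inter> B) = 0}"
    using locally_finite[OF _ assms(2)] by auto
  then show "{\<omega> \<in> space M. N \<omega> \<inter> B = {}} \<in> events"
    and "prob {\<omega> \<in> space M. N \<omega> \<inter> B = {}} = exp (- measure lborel B)"
    using count_sets[OF assms, of "\<lambda>k. k = 0"] count_poisson[OF assms, of 0] by simp_all
qed

lemma prob_count_ge_2:
  assumes "B \<in> sets borel" "bounded B" "B \<subseteq> strip"
  shows "prob {\<omega> \<in> space M. 2 \<le> card (N \<omega> \<inter> B)} \<le> (measure lborel B)\<^sup>2"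
proof -
  let ?c = "\<lambda>\<omega>. card (N \<omega> \<inter> B)"
  have "prob {\<omega> \<in> space M. ?c \<omega> < 2} = prob ({\<omega> \<in> space M. ?c \<omega> = 0} \<union> {\<omega> \<in> space M. ?c \<omega> = 1})"
    by (rule arg_cong[where f = prob]) auto
  also have "\<dots> = prob {\<omega> \<in> space M. ?c \<omega> = 0} + prob {\<omega> \<in> space M. ?c \<omega> = 1}"
    by (rule finite_measure_Union) (auto intro!: count_sets[OF assms])
  also have "\<dots> = exp (- measure lborel B) + measure lborel B * exp (- measure lborel B)"
    using count_poisson[OF assms, of 0] count_poisson[OF assms, of 1] by simp
  finally have 1: "prob {\<omega> \<in> space M. ?c \<omega> < 2} =
    exp (- measure lborel B) + measure lborel B * exp (- measure lborel B)" .
  have "prob {\<omega> \<in> space M. 2 \<le> ?c \<omega>} = 1 - prob {\<omega> \<in> space M. ?c \<omega> < 2}"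
    by (subst prob_compl[symmetric, OF count_sets[OF assms]])
       (auto intro!: arg_cong[where f = prob])
  then show ?thesis
    using 1 poisson_two_or_more[of "measure lborel B"] by simp
qed

lemma count_indep2:
  assumes A: "A \<in> sets borel" "bounded A" "A \<subseteq> strip"
    and B: "B \<in> sets borel" "bounded B" "B \<subseteq> strip" and "A \<inter> B = {}"
  shows "prob {\<omega> \<in> space M. card (N \<omega> \<inter> A) = j \<and> card (N \<omega> \<inter> B) = k} =
    prob {\<omega> \<in> space M. card (N \<omega> \<inter> A) = j} * prob {\<omega> \<in> space M. card (N \<omega> \<inter> B) = k}"
proof -
  let ?C = "\<lambda>i::nat. if i = 0 then A else B"
  let ?K = "\<lambda>i::nat. if i = 0 then {j} else {k}"
  have "indep_vars (\<lambda>_. count_space UNIV) (\<lambda>i \<omega>. card (N \<omega> \<inter> ?C i)) {0, 1::nat}"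
    using assms by (intro count_indep) (auto simp: disjoint_family_on_def)
  then have "prob (\<Inter>i\<in>{0,1}. (\<lambda>\<omega>. card (N \<omega> \<inter> ?C i)) -` ?K i \<inter> space M) =
      (\<Prod>i\<in>{0,1}. prob ((\<lambda>\<omega>. card (N \<omega> \<inter> ?C i)) -` ?K i \<inter> space M))"
    by (intro indep_varsD) auto
  moreover have "(\<Inter>i\<in>{0,1::nat}. (\<lambda>\<omega>. card (N \<omega> \<inter> ?C i)) -` ?K i \<inter> space M) =
    {\<omega> \<in> space M. card (N \<omega> \<inter> A) = j \<and> card (N \<omega> \<inter> B) = k}" by auto
  moreover have "(\<lambda>\<omega>. card (N \<omega> \<inter> A)) -` {j} \<inter> space M = {\<omega> \<in> space M. card (N \<omega> \<inter> A) = j}"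
    "(\<lambda>\<omega>. card (N \<omega> \<inter> B)) -` {k} \<inter> space M = {\<omega> \<in> space M. card (N \<omega> \<inter> B) = k}" by auto
  ultimately show ?thesis by simp
qed

text \<open>The Mecke formula in its elementary case, where the region to be avoided does not depend
  on the atom: disjointness makes the two counts independent, and summing over the values of the
  count in \<open>B\<close> reproduces its mean.\<close>

lemma nn_integral_count_avoid:
  assumes A: "A \<in> sets borel" "bounded A" "A \<subseteq> strip"
    and B: "B \<in> sets borel" "bounded B" "B \<subseteq> strip" and AB: "A \<inter> B = {}"
  shows "(\<integral>\<^sup>+\<omega>. indicator {\<omega> \<in> space M. N \<omega> \<inter> A = {}} \<omega> * of_nat (card (N \<omega> \<inter> B)) \<partial>M) =
    ennreal (exp (- measure lborel A)) * emeasure lborel B"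
proof -
  let ?E = "\<lambda>k. {\<omega> \<in> space M. card (N \<omega> \<inter> A) = 0 \<and> card (N \<omega> \<inter> B) = k}"
  have E: "?E k \<in> events" for k
  proof -
    have "?E k = {\<omega> \<in> space M. card (N \<omega> \<inter> A) = 0} \<inter> {\<omega> \<in> space M. card (N \<omega> \<inter> B) = k}" by auto
    then show ?thesis using count_sets[OF A] count_sets[OF B] by auto
  qed
  have PE: "prob (?E k) = exp (- measure lborel A) * (measure lborel B ^ k / fact k * exp (- measure lborel B))" for k
    using count_indep2[OF A B AB, of 0 k] count_poisson[OF A, of 0] count_poisson[OF B, of k] by simp
  have "(\<integral>\<^sup>+\<omega>. indicator {\<omega> \<in> space M. N \<omega> \<inter> A = {}} \<omega> * of_nat (card (N \<omega> \<inter> B)) \<partial>M) =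
    (\<integral>\<^sup>+\<omega>. (\<Sum>k. of_nat k * indicator (?E k) \<omega>) \<partial>M)"
  proof (rule nn_integral_cong)
    fix \<omega> assume w: "\<omega> \<in> space M"
    have "(\<Sum>k. of_nat k * indicator (?E k) \<omega>) =
        (\<Sum>k\<in>{card (N \<omega> \<inter> B)}. of_nat k * indicator (?E k) \<omega> :: ennreal)"
      by (rule suminf_finite) (auto simp: indicator_def)
    also have "\<dots> = indicator {\<omega> \<in> space M. N \<omega> \<inter> A = {}} \<omega> * of_nat (card (N \<omega> \<inter> B))"
      using w locally_finite[OF w A(2)] by (auto simp: indicator_def)
    finally show "indicator {\<omega> \<in> space M. N \<omega> \<inter> A = {}} \<omega> * of_nat (card (N \<omega> \<inter> B)) =
      (\<Sum>k. of_nat k * indicator (?E k) \<omega> :: ennreal)" by simp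
  qed
  also have "\<dots> = (\<Sum>k. \<integral>\<^sup>+\<omega>. of_nat k * indicator (?E k) \<omega> \<partial>M)"
    using E by (intro nn_integral_suminf) auto
  also have "\<dots> = (\<Sum>k. ennreal (exp (- measure lborel A)) *
      ennreal (real k * (measure lborel B ^ k / fact k * exp (- measure lborel B))))"
    using E
    by (intro suminf_cong)
       (simp add: nn_integral_cmult emeasure_eq_measure PE ennreal_of_nat_eq_real_of_nat
         ennreal_mult[symmetric] mult_ac)
  also have "\<dots> = ennreal (exp (- measure lborel A)) * ennreal (measure lborel B)"
    by (simp only: ennreal_suminf_cmult poisson_mean[OF measure_nonneg])
  also have "ennreal (measure lborel B) = emeasure lborel B"
    using emeasure_bounded_finite[OF B(2)] by (simp add: measure_def)
  finally show ?thesis .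
qed

lemma min_atom_time_measurable:
  fixes key :: "real \<times> real \<Rightarrow> real"
  assumes S: "S \<in> sets borel" "S \<subseteq> strip"
    and bd: "\<And>r. r \<in> U \<Longrightarrow> bounded {q \<in> S. key q \<le> r}"
    and U: "open U" "key ` S \<subseteq> U" and key: "continuous_on UNIV key"
  shows "(\<lambda>\<omega>. fst (min_atom key (N \<omega> \<inter> S))) \<in> borel_measurable M"
proof -
  have fin: "finite {q \<in> N \<omega> \<inter> S. key q \<le> r}" if "\<omega> \<in> space M" "r \<in> U" for \<omega> r
    using locally_finite[OF that(1) bd[OF that(2)]] by (simp add: Int_def conj_assoc)
  have cl: "closed {q. key q \<le> r}" "closed {q :: real \<times> real. fst q \<le> r}" for r
    by (intro closed_Collect_le continuous_intros key)+
  have b1: "{q \<in> S. key q \<le> r} \<in> sets borel" "{q \<in> S. key q \<le> r \<and> fst q \<le> a} \<in> sets borel" for r a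
  proof -
    have "{q \<in> S. key q \<le> r} = S \<inter> {q. key q \<le> r}"
      "{q \<in> S. key q \<le> r \<and> fst q \<le> a} = S \<inter> {q. key q \<le> r} \<inter> {q. fst q \<le> a}" by auto
    then show "{q \<in> S. key q \<le> r} \<in> sets borel" "{q \<in> S. key q \<le> r \<and> fst q \<le> a} \<in> sets borel"
      using S borel_closed[OF cl(1)] borel_closed[OF cl(2)] by auto
  qed
  show ?thesis
    unfolding borel_measurable_iff_le
  proof
    fix a :: real
    show "{\<omega> \<in> space M. fst (min_atom key (N \<omega> \<inter> S)) \<le> a} \<in> events"
    proof (cases "a < 1")
      case True
      have "{\<omega> \<in> space M. fst (min_atom key (N \<omega> \<inter> S)) \<le> a} =
        (\<Union>r\<in>U \<inter> \<rat>. {\<omega> \<in> space M. card (N \<omega> \<inter> {q \<in> S. key q \<le> r}) = 1} \<inter>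
          {\<omega> \<in> space M. card (N \<omega> \<inter> {q \<in> S. key q \<le> r \<and> fst q \<le> a}) = 1})"
        (is "_ = ?R")
      proof -
        have "fst (min_atom key (N \<omega> \<inter> S)) \<le> a \<longleftrightarrow>
          (\<exists>r\<in>U \<inter> \<rat>. card (N \<omega> \<inter> {q \<in> S. key q \<le> r}) = 1 \<and> card (N \<omega> \<inter> {q \<in> S. key q \<le> r \<and> fst q \<le> a}) = 1)"
          if "\<omega> \<in> space M" for \<omega>
          using min_atom_time_le_iff[where key = key and A = "N \<omega> \<inter> S", OF fin[OF that] U(1) _ True] U(2)
          by (auto simp: Int_def conj_assoc image_subset_iff)
        then show ?thesis by auto
      qed
      also have "\<dots> \<in> events"
        using S bd b1
        by (intro sets.countable_UN'' sets.Int count_sets countable_Int2 countable_rat)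
           (auto intro: bounded_subset[OF bd])
      finally show ?thesis .
    next
      case False
      have "fst (min_atom key (N \<omega> \<inter> S)) \<le> a" if w: "\<omega> \<in> space M" for \<omega>
      proof (cases "\<exists>p\<in>N \<omega> \<inter> S. \<forall>q\<in>N \<omega> \<inter> S. q \<noteq> p \<longrightarrow> key p < key q")
        case True
        then obtain p where p: "p \<in> N \<omega> \<inter> S" "\<And>q. q \<in> N \<omega> \<inter> S \<Longrightarrow> q \<noteq> p \<Longrightarrow> key p < key q" by blast
        then show ?thesis using min_atom_eq[where key = key, OF p] False S(2) by (auto simp: strip_def)
      next
        case F: False
        then show ?thesis using False min_atom_none[OF F] by simp
      qed
      then have "{\<omega> \<in> space M. fst (min_atom key (N \<omega> \<inter> S)) \<le> a} = space M" by blast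
      then show ?thesis by simp
    qed
  qed
qed

lemma best_time_measurable: "(\<lambda>\<omega>. best_time (N \<omega>)) \<in> borel_measurable M"
proof -
  have "(\<lambda>\<omega>. fst (min_atom snd (N \<omega> \<inter> strip))) \<in> borel_measurable M"
  proof (rule min_atom_time_measurable[where U = UNIV])
    show "bounded {q \<in> strip. snd q \<le> r}" for r
      by (rule bounded_subset[where T = "{0..1} \<times> {0..r}"]) (auto simp: strip_def intro: bounded_Times)
  qed (auto intro: continuous_intros)
  moreover have "N \<omega> \<inter> strip = N \<omega>" if "\<omega> \<in> space M" for \<omega>
    using atoms_in_strip[OF that] by blast
  ultimately show ?thesis
    unfolding best_time_def best_atom_def by (simp cong: measurable_cong)
qed

lemma memoryless_time_measurable:
  assumes "curve f"
  shows "(\<lambda>\<omega>. memoryless_time f (N \<omega>)) \<in> borel_measurable M"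
proof -
  interpret curve f by fact
  show ?thesis
    unfolding memoryless_time_def memoryless_point_def
  proof (rule min_atom_time_measurable[where U = "{..<1}"])
    show "bounded {q \<in> subgraph f. fst q \<le> r}" if "r \<in> {..<1}" for r
      using that bounded_subgraph by simp
    show "fst ` subgraph f \<subseteq> {..<1}" using subgraph_time by auto
    show "subgraph f \<subseteq> strip" by (rule subgraph_strip)
  qed (auto intro: continuous_intros)
qed

text \<open>Slice the box into n closed strips according to the key. A tie puts two atoms into a
  common strip, which has probability at most (C L / n)^2 for each strip, hence at most (C L)^2 / n
  in all, for every n.\<close>

lemma AE_no_ties_on_box:
  fixes key :: "real \<times> real \<Rightarrow> real"
  assumes B: "B \<in> sets borel" "bounded B" "B \<subseteq> strip"
    and key: "continuous_on UNIV key" "key ` B \<subseteq> {0..L}" "0 < L" and "0 \<le> C"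
    and le: "\<And>a b. a \<le> b \<Longrightarrow> measure lborel (B \<inter> {p. a \<le> key p \<and> key p \<le> b}) \<le> C * (b - a)"
  shows "AE \<omega> in M. inj_on key (N \<omega> \<inter> B)"
proof -
  define D where "D n i = B \<inter> {p. real i * L / real n \<le> key p \<and> key p \<le> (real i + 1) * L / real n}"
    for n i :: nat
  define E where "E n i = {\<omega> \<in> space M. 2 \<le> card (N \<omega> \<inter> D n i)}" for n i
  have D: "D n i \<in> sets borel" "bounded (D n i)" "D n i \<subseteq> strip" for n i
  proof -
    have "closed {p. real i * L / real n \<le> key p \<and> key p \<le> (real i + 1) * L / real n}"
      by (intro closed_Collect_conj closed_Collect_le continuous_intros key)
    then show "D n i \<in> sets borel" unfolding D_def using B borel_closed by (intro sets.Int) blast+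
    show "bounded (D n i)" "D n i \<subseteq> strip" unfolding D_def using B bounded_Int by auto
  qed
  have E: "E n i \<in> events" for n i unfolding E_def by (intro count_sets D)
  define G where "G n = (\<Union>i<Suc n. E (Suc n) i)" for n
  have G: "G n \<in> events" for n unfolding G_def using E by auto
  have PG: "prob (G n) \<le> (C * L)\<^sup>2 * inverse (real (Suc n))" for n
  proof -
    have "prob (G n) \<le> (\<Sum>i<Suc n. prob (E (Suc n) i))"
      unfolding G_def using E by (intro finite_measure_subadditive_finite) auto
    also have "\<dots> \<le> (\<Sum>i<Suc n. (C * L / real (Suc n))\<^sup>2)"
    proof (rule sum_mono)
      fix i
      have "measure lborel (D (Suc n) i) \<le> C * ((real i + 1) * L / real (Suc n) - real i * L / real (Suc n))"
        unfolding D_def by (rule le) (use key in \<open>auto intro!: divide_right_mono mult_right_mono\<close>)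
      also have "(real i + 1) * L / m - real i * L / m = L / m" for m
        by (simp add: diff_divide_distrib[symmetric] algebra_simps)
      finally have "(measure lborel (D (Suc n) i))\<^sup>2 \<le> (C * L / real (Suc n))\<^sup>2"
        by (intro power_mono) auto
      then show "prob (E (Suc n) i) \<le> (C * L / real (Suc n))\<^sup>2"
        using prob_count_ge_2[OF D, of "Suc n" i] unfolding E_def by linarith
    qed
    also have "\<dots> = (C * L)\<^sup>2 * inverse (real (Suc n))"
      by (simp add: power2_eq_square divide_simps)
    finally show ?thesis .
  qed
  have "prob (\<Inter>n. G n) = 0"
  proof -
    have "prob (\<Inter>n. G n) \<le> (C * L)\<^sup>2 * inverse (real (Suc n))" for n
      using finite_measure_mono[of "\<Inter>n. G n" "G n"] G PG[of n] by (auto intro: order_trans)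
    moreover have "(\<lambda>n. (C * L)\<^sup>2 * inverse (real (Suc n))) \<longlonglongrightarrow> (C * L)\<^sup>2 * 0"
      by (intro tendsto_intros LIMSEQ_inverse_real_of_nat)
    ultimately have "prob (\<Inter>n. G n) \<le> (C * L)\<^sup>2 * 0"
      by (intro LIMSEQ_le_const) auto
    then show ?thesis by (simp add: measure_le_0_iff)
  qed
  then have null: "(\<Inter>n. G n) \<in> null_sets M"
    using G by (intro null_setsI) (auto simp: emeasure_eq_measure)
  have "{\<omega> \<in> space M. \<not> inj_on key (N \<omega> \<inter> B)} \<subseteq> (\<Inter>n. G n)"
  proof safe
    fix \<omega> n assume w: "\<omega> \<in> space M" and "\<not> inj_on key (N \<omega> \<inter> B)"
    then obtain p q where pq: "p \<in> N \<omega> \<inter> B" "q \<in> N \<omega> \<inter> B" "p \<noteq> q" "key p = key q"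
      by (auto simp: inj_on_def)
    define y where "y = key p * real (Suc n) / L"
    have k: "0 \<le> key p" "key p \<le> L" using pq key by auto
    \<comment> \<open>The largest key \<open>L\<close> gives \<open>y = Suc n\<close>, one past the
      last index \<open>n\<close>; the minimum moves it into the last strip, which is
      closed.\<close>
    define i where "i = min n (nat \<lfloor>y\<rfloor>)"
    have "y \<le> L * real (Suc n) / L"
      unfolding y_def using k key(3) by (intro divide_right_mono mult_right_mono) auto
    then have y: "0 \<le> y" "y \<le> real (Suc n)" using k key(3) by (simp_all add: y_def)
    have "real i \<le> y \<and> y \<le> real i + 1"
      unfolding i_def using y by linarith
    then have "real i * L / real (Suc n) \<le> key p \<and> key p \<le> (real i + 1) * L / real (Suc n)"
      using key(3) by (simp add: y_def field_simps)
    then have "{p, q} \<subseteq> N \<omega> \<inter> D (Suc n) i" using pq by (auto simp: D_def)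
    then have "card {p, q} \<le> card (N \<omega> \<inter> D (Suc n) i)"
      using locally_finite[OF w D(2)] by (intro card_mono)
    then have "\<omega> \<in> E (Suc n) i" using pq(3) w by (simp add: E_def)
    then show "\<omega> \<in> G n" unfolding G_def i_def by auto
  qed
  then show ?thesis using null by (intro AE_I'[OF null]) auto
qed

end

section \<open>Dyadic approximation of blocking regions from below\<close>

definition lower_dyadic :: "nat \<Rightarrow> real \<Rightarrow> real" where
  "lower_dyadic n x = (of_int \<lceil>2 ^ n * x\<rceil> - 1) / 2 ^ n"

lemma lower_dyadic_less: "lower_dyadic n x < x"
proof -
  have "of_int \<lceil>2 ^ n * x\<rceil> - 1 < 2 ^ n * x" by linarith
  then show ?thesis by (simp add: lower_dyadic_def field_simps)
qed

lemma lower_dyadic_ge: "x - (1 / 2) ^ n \<le> lower_dyadic n x"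
proof -
  have "2 ^ n * x - 1 \<le> of_int \<lceil>2 ^ n * x\<rceil> - 1" by linarith
  then show ?thesis by (simp add: lower_dyadic_def field_simps)
qed

lemma lower_dyadic_tendsto: "(\<lambda>n. lower_dyadic n x) \<longlonglongrightarrow> x"
proof (rule tendsto_sandwich)
  have "(\<lambda>n. x - (1 / 2) ^ n) \<longlonglongrightarrow> x - 0"
    by (intro tendsto_intros) auto
  then show "(\<lambda>n. x - (1 / 2) ^ n) \<longlonglongrightarrow> x" by simp
qed (auto intro!: always_eventually less_imp_le lower_dyadic_less lower_dyadic_ge)

lemma lower_dyadic_measurable[measurable]: "lower_dyadic n \<in> borel_measurable borel"
  unfolding lower_dyadic_def by measurable

lemma finite_lower_dyadic_image:
  assumes "bounded X"
  shows "finite (lower_dyadic n ` X)"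
proof -
  obtain a where a: "\<And>x. x \<in> X \<Longrightarrow> \<bar>x\<bar> \<le> a"
    using assms by (auto simp: bounded_iff)
  have "lower_dyadic n ` X \<subseteq> (\<lambda>k. (of_int k - 1) / 2 ^ n) ` {\<lceil>2 ^ n * - a\<rceil>..\<lceil>2 ^ n * a\<rceil>}"
  proof
    fix y assume "y \<in> lower_dyadic n ` X"
    then obtain x where x: "x \<in> X" "y = lower_dyadic n x" by blast
    have "\<lceil>2 ^ n * x\<rceil> \<in> {\<lceil>2 ^ n * - a\<rceil>..\<lceil>2 ^ n * a\<rceil>}"
      using a[OF x(1)] by (auto intro!: ceiling_mono simp: abs_le_iff)
        (metis minus_le_iff mult_minus_right mult_left_mono zero_le_numeral zero_le_power)
    then show "y \<in> (\<lambda>k. (of_int k - 1) / 2 ^ n) ` {\<lceil>2 ^ n * - a\<rceil>..\<lceil>2 ^ n * a\<rceil>}"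
      unfolding x(2) lower_dyadic_def by blast
  qed
  then show ?thesis by (rule finite_subset) auto
qed

text \<open>Passing to the lower left corner shrinks the blocking region, keeps it disjoint from the
  cell of points with this corner, and leaves only finitely many regions for a bounded set of
  points.\<close>

definition lower_corner :: "nat \<Rightarrow> real \<times> real \<Rightarrow> real \<times> real" where
  "lower_corner n p = (lower_dyadic n (fst p), lower_dyadic n (snd p))"

lemma lower_corner_measurable[measurable]: "lower_corner n \<in> borel \<rightarrow>\<^sub>M borel"
  unfolding lower_corner_def borel_prod[symmetric] by measurable

lemma finite_lower_corner_image:
  assumes "bounded S"
  shows "finite (lower_corner n ` S)"
proof -
  have "lower_corner n ` S \<subseteq> lower_dyadic n ` (fst ` S) \<times> lower_dyadic n ` (snd ` S)"
    by (auto simp: lower_corner_def)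
  then show ?thesis
    by (rule finite_subset)
       (intro finite_cartesian_product finite_lower_dyadic_image bounded_fst bounded_snd assms)
qed

lemma blocking_lower_corner_subset: "blocking f (lower_corner n p) \<subseteq> blocking f p"
  using lower_dyadic_less[of n "fst p"] lower_dyadic_less[of n "snd p"]
  by (auto simp: blocking_def lower_corner_def)

text \<open>The inequalities that put \<open>q\<close> into the region are strict and thus survive a
  small decrease of the coordinates of \<open>p\<close>; conversely the regions of the corners lie
  inside that of \<open>p\<close>.\<close>

lemma eventually_mem_blocking_lower_corner:
  "eventually (\<lambda>n. q \<in> blocking f (lower_corner n p) \<longleftrightarrow> q \<in> blocking f p) sequentially"
proof (cases "q \<in> blocking f p")
  case True
  then consider "q \<in> strip" "fst q < fst p" "q \<in> subgraph f" | "q \<in> strip" "snd q < snd p"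
    by (auto simp: blocking_def)
  then show ?thesis
  proof cases
    case 1
    have "eventually (\<lambda>n. fst q < lower_dyadic n (fst p)) sequentially"
      using order_tendstoD(1)[OF lower_dyadic_tendsto 1(2)] .
    then show ?thesis
      by eventually_elim (use 1 True in \<open>auto simp: blocking_def lower_corner_def\<close>)
  next
    case 2
    have "eventually (\<lambda>n. snd q < lower_dyadic n (snd p)) sequentially"
      using order_tendstoD(1)[OF lower_dyadic_tendsto 2(2)] .
    then show ?thesis
      by eventually_elim (use 2 True in \<open>auto simp: blocking_def lower_corner_def\<close>)
  qed
qed (use blocking_lower_corner_subset[of f _ p] in \<open>auto intro!: always_eventually\<close>)

lemma (in curve) measure_blocking_lower_corner_tendsto:
  assumes "fst p < 1"
  shows "(\<lambda>n. measure lborel (blocking f (lower_corner n p))) \<longlonglongrightarrow> measure lborel (blocking f p)"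
proof -
  have fin: "emeasure lborel (blocking f p) < \<infinity>"
    by (intro emeasure_bounded_finite bounded_blocking assms)
  have "(\<lambda>n. \<integral>\<^sup>+q. indicator (blocking f (lower_corner n p)) q \<partial>lborel)
    \<longlonglongrightarrow> (\<integral>\<^sup>+q. indicator (blocking f p) q \<partial>lborel)"
  proof (rule nn_integral_dominated_convergence[where w = "indicator (blocking f p)"])
    show "AE q in lborel. (\<lambda>n. indicator (blocking f (lower_corner n p)) q :: ennreal)
        \<longlonglongrightarrow> indicator (blocking f p) q"
    proof (rule AE_I2)
      fix q
      show "(\<lambda>n. indicator (blocking f (lower_corner n p)) q :: ennreal) \<longlonglongrightarrow> indicator (blocking f p) q"
        by (rule tendsto_eventually, rule eventually_mono[OF eventually_mem_blocking_lower_corner[of q f p]])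
           (auto simp: indicator_def)
    qed
    show "AE q in lborel. indicator (blocking f (lower_corner n p)) q \<le> (indicator (blocking f p) q :: ennreal)" for n
      using blocking_lower_corner_subset[of f n p] by (auto simp: indicator_def)
  qed (use fin in auto)
  then have "(\<lambda>n. emeasure lborel (blocking f (lower_corner n p))) \<longlonglongrightarrow> emeasure lborel (blocking f p)"
    by simp
  then show ?thesis
    unfolding measure_def using fin by (intro tendsto_enn2real) auto
qed

lemma measure_lborel_rectangle:
  fixes a b c d :: real
  assumes "a \<le> b" "c \<le> d"
  shows "measure lborel ({a..b} \<times> {c..d}) = (b - a) * (d - c)"
  using content_Pair[of a c b d] assms by (simp add: cbox_Pair_eq)

section \<open>Almost sure properties of the atoms and the description of success\<close>

context unit_rate_poisson_process
begin

lemma AE_no_ties: "AE \<omega> in M. inj_on fst (N \<omega>) \<and> inj_on snd (N \<omega>)"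
proof -
  define B :: "nat \<Rightarrow> (real \<times> real) set" where "B k = {0..1} \<times> {0..real k + 1}" for k
  have B: "B k \<in> sets borel" "bounded (B k)" "B k \<subseteq> strip" for k
    unfolding B_def strip_def
    by (intro borel_closed closed_Times closed_atLeastAtMost, intro bounded_Times, auto)
  have meas_le: "measure lborel (B k \<inter> X) \<le> measure lborel R"
    if "B k \<inter> X \<subseteq> R" "closed X" "R \<in> sets borel" "bounded R" for k X and R :: "(real \<times> real) set"
    using that B emeasure_bounded_finite[of R] borel_closed[of X]
    by (intro measure_mono_fmeasurable) (auto simp: fmeasurable_def)
  have rect: "{a..b} \<times> {c..d} \<in> sets (borel :: (real \<times> real) measure)"
    "bounded ({a..b} \<times> {c..d})" for a b c d :: real
    by (intro borel_closed closed_Times closed_atLeastAtMost, intro bounded_Times, auto)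
  have "AE \<omega> in M. inj_on fst (N \<omega> \<inter> B k)" for k
  proof (rule AE_no_ties_on_box[OF B, where L = 1 and C = "real k + 1"])
    fix a b :: real assume ab: "a \<le> b"
    have "measure lborel (B k \<inter> {p. a \<le> fst p \<and> fst p \<le> b}) \<le> measure lborel ({a..b} \<times> {0..real k + 1})"
      by (rule meas_le) (auto simp: B_def intro!: rect closed_Collect_conj closed_Collect_le continuous_intros)
    then show "measure lborel (B k \<inter> {p. a \<le> fst p \<and> fst p \<le> b}) \<le> (real k + 1) * (b - a)"
      using ab by (simp add: measure_lborel_rectangle mult.commute)
  qed (auto simp: B_def intro: continuous_intros)
  moreover have "AE \<omega> in M. inj_on snd (N \<omega> \<inter> B k)" for k
  proof (rule AE_no_ties_on_box[OF B, where L = "real k + 1" and C = 1])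
    fix a b :: real assume ab: "a \<le> b"
    have "measure lborel (B k \<inter> {p. a \<le> snd p \<and> snd p \<le> b}) \<le> measure lborel ({0..1::real} \<times> {a..b})"
      by (rule meas_le) (auto simp: B_def intro!: rect closed_Collect_conj closed_Collect_le continuous_intros)
    then show "measure lborel (B k \<inter> {p. a \<le> snd p \<and> snd p \<le> b}) \<le> 1 * (b - a)"
      using ab measure_lborel_rectangle[of 0 1 a b] by simp
  qed (auto simp: B_def intro: continuous_intros)
  ultimately have "AE \<omega> in M. \<forall>k. inj_on fst (N \<omega> \<inter> B k) \<and> inj_on snd (N \<omega> \<inter> B k)"
    by (simp add: AE_all_countable)
  then show ?thesis
  proof (rule AE_mp, intro AE_I2 impI)
    fix \<omega> assume w: "\<omega> \<in> space M" and inj: "\<forall>k. inj_on fst (N \<omega> \<inter> B k) \<and> inj_on snd (N \<omega> \<inter> B k)"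
    have cover: "\<exists>k. {p, q} \<subseteq> N \<omega> \<inter> B k" if "p \<in> N \<omega>" "q \<in> N \<omega>" for p q
    proof -
      obtain k where "max (snd p) (snd q) \<le> real k" using real_arch_simple by blast
      then show ?thesis using that atoms_in_strip[OF w]
        by (intro exI[of _ k]) (force simp: B_def strip_def)
    qed
    show "inj_on fst (N \<omega>) \<and> inj_on snd (N \<omega>)"
    proof (intro conjI inj_onI)
      fix p q assume "p \<in> N \<omega>" "q \<in> N \<omega>" and eq: "fst p = fst q"
      then obtain k where "{p, q} \<subseteq> N \<omega> \<inter> B k" using cover by blast
      then show "p = q" using inj eq by (meson inj_onD insert_subset)
    next
      fix p q assume "p \<in> N \<omega>" "q \<in> N \<omega>" and eq: "snd p = snd q"
      then obtain k where "{p, q} \<subseteq> N \<omega> \<inter> B k" using cover by blast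
      then show "p = q" using inj eq by (meson inj_onD insert_subset)
    qed
  qed
qed

lemma AE_nonempty: "AE \<omega> in M. N \<omega> \<noteq> {}"
proof -
  define B :: "nat \<Rightarrow> (real \<times> real) set" where "B k = {0..1} \<times> {0..real k}" for k
  define E where "E k = {\<omega> \<in> space M. N \<omega> \<inter> B k = {}}" for k
  have B: "B k \<in> sets borel" "bounded (B k)" "B k \<subseteq> strip" for k
    unfolding B_def strip_def
    by (intro borel_closed closed_Times closed_atLeastAtMost, intro bounded_Times, auto)
  have E: "E k \<in> events" "prob (E k) = exp (- real k)" for k
    using count_avoid[OF B, of k] measure_lborel_rectangle[of 0 1 0 "real k"]
    by (auto simp: E_def B_def)
  have "prob (\<Inter>k. E k) \<le> exp (- real k)" for k
    using finite_measure_mono[of "\<Inter>k. E k" "E k"] E by auto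
  moreover have "(\<lambda>k. exp (- real k)) \<longlonglongrightarrow> 0" by real_asymp
  ultimately have "prob (\<Inter>k. E k) \<le> 0" by (intro LIMSEQ_le_const) auto
  then have null: "(\<Inter>k. E k) \<in> null_sets M"
    using E by (intro null_setsI) (auto simp: emeasure_eq_measure measure_le_0_iff)
  show ?thesis
    by (rule AE_I'[OF null]) (auto simp: E_def)
qed

text \<open>An atom at time 1, if it were the best one, would let the default stopping time count as
  a success.\<close>

lemma AE_time_less_1: "AE \<omega> in M. \<forall>p\<in>N \<omega>. fst p < 1"
proof -
  define B :: "nat \<Rightarrow> (real \<times> real) set" where "B k = {1..1} \<times> {0..real k}" for k
  have B: "B k \<in> sets borel" "bounded (B k)" "B k \<subseteq> strip" for k
    unfolding B_def strip_def
    by (intro borel_closed closed_Times closed_atLeastAtMost, intro bounded_Times, auto)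
  have "AE \<omega> in M. N \<omega> \<inter> B k = {}" for k
  proof -
    have "prob {\<omega> \<in> space M. N \<omega> \<inter> B k = {}} = 1"
      using count_avoid[OF B, of k] measure_lborel_rectangle[of 1 1 0 "real k"]
      by (auto simp: B_def)
    then show ?thesis using prob_Collect_eq_1[OF count_avoid(1)[OF B]] by simp
  qed
  then have "AE \<omega> in M. \<forall>k. N \<omega> \<inter> B k = {}" by (simp add: AE_all_countable)
  then show ?thesis
  proof (rule AE_mp, intro AE_I2 impI ballI)
    fix \<omega> p assume w: "\<omega> \<in> space M" and e: "\<forall>k. N \<omega> \<inter> B k = {}" and p: "p \<in> N \<omega>"
    obtain k where k: "snd p \<le> real k" using real_arch_simple by blast
    have "p \<in> strip" using atoms_in_strip[OF w] p by blast
    moreover have "p \<notin> B k" using e p by blast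
    ultimately show "fst p < 1" using k by (cases p) (auto simp: B_def strip_def)
  qed
qed

lemma memoryless_time_eq:
  assumes w: "\<omega> \<in> space M" and "curve f" and inj: "inj_on fst (N \<omega>)" and ne: "N \<omega> \<inter> subgraph f \<noteq> {}"
  obtains p where "p \<in> N \<omega> \<inter> subgraph f" "\<And>q. q \<in> N \<omega> \<inter> subgraph f \<Longrightarrow> q \<noteq> p \<Longrightarrow> fst p < fst q"
    "memoryless_time f (N \<omega>) = fst p"
proof -
  interpret curve f by fact
  have "\<exists>p\<in>N \<omega> \<inter> subgraph f. \<forall>q\<in>N \<omega> \<inter> subgraph f. fst p \<le> fst q"
  proof (rule ex_min_on_levels[where U = "{..<1}"])
    show "finite {q \<in> N \<omega> \<inter> subgraph f. fst q \<le> r}" if "r \<in> {..<1}" for r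
      using locally_finite[OF w bounded_subgraph[of r]] that by (simp add: Int_def conj_assoc)
    show "fst ` (N \<omega> \<inter> subgraph f) \<subseteq> {..<1}" using subgraph_time by auto
  qed fact
  then obtain p where p: "p \<in> N \<omega> \<inter> subgraph f" "\<And>q. q \<in> N \<omega> \<inter> subgraph f \<Longrightarrow> fst p \<le> fst q" by blast
  have s: "fst p < fst q" if "q \<in> N \<omega> \<inter> subgraph f" "q \<noteq> p" for q
  proof -
    have "fst p \<noteq> fst q" using inj_onD[OF inj, of p q] that p(1) by blast
    then show ?thesis using p(2)[OF that(1)] by simp
  qed
  have "min_atom fst (N \<omega> \<inter> subgraph f) = (fst p, ereal (snd p))"
    by (rule min_atom_eq) (use p s in auto)
  then show thesis
    by (intro that[OF p(1) s]) (simp_all add: memoryless_time_def memoryless_point_def)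
qed

lemma best_time_eq:
  assumes w: "\<omega> \<in> space M" and inj: "inj_on snd (N \<omega>)" and ne: "N \<omega> \<noteq> {}"
  obtains p where "p \<in> N \<omega>" "\<And>q. q \<in> N \<omega> \<Longrightarrow> q \<noteq> p \<Longrightarrow> snd p < snd q"
    "best_time (N \<omega>) = fst p"
proof -
  have "\<exists>p\<in>N \<omega>. \<forall>q\<in>N \<omega>. snd p \<le> snd q"
  proof (rule ex_min_on_levels[where U = UNIV])
    show "finite {q \<in> N \<omega>. snd q \<le> r}" for r
    proof (rule finite_subset)
      show "{q \<in> N \<omega>. snd q \<le> r} \<subseteq> N \<omega> \<inter> ({0..1} \<times> {0..r})"
        using atoms_in_strip[OF w] by (auto simp: strip_def)
      show "finite (N \<omega> \<inter> ({0..1} \<times> {0..r}))"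
        by (intro locally_finite[OF w] bounded_Times) auto
    qed
  qed (use ne in auto)
  then obtain p where p: "p \<in> N \<omega>" "\<And>q. q \<in> N \<omega> \<Longrightarrow> snd p \<le> snd q" by blast
  have s: "snd p < snd q" if "q \<in> N \<omega>" "q \<noteq> p" for q
  proof -
    have "snd p \<noteq> snd q" using inj_onD[OF inj, of p q] that p(1) by blast
    then show ?thesis using p(2)[OF that(1)] by simp
  qed
  show thesis
    by (rule that[OF p(1) s])
       (auto simp: best_time_def best_atom_def min_atom_eq[where key = snd, OF p(1) s])
qed

text \<open>Without ties, equal times mean equal atoms, so success says that the first atom of the
  subgraph is the best one. Conversely, an unblocked atom is preceded by no atom of the subgraph and
  beaten by none, so it is both at once. If no atom lies in the subgraph, the default time 1 differs
  from the time of the best atom.\<close>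

lemma AE_success_iff:
  assumes "curve f"
  shows "AE \<omega> in M. memoryless_time f (N \<omega>) = best_time (N \<omega>) \<longleftrightarrow>
    (\<exists>p\<in>N \<omega> \<inter> subgraph f. N \<omega> \<inter> blocking f p = {})"
proof -
  have "AE \<omega> in M. (inj_on fst (N \<omega>) \<and> inj_on snd (N \<omega>)) \<and> N \<omega> \<noteq> {} \<and> (\<forall>p\<in>N \<omega>. fst p < 1)"
    using AE_no_ties AE_nonempty AE_time_less_1 by eventually_elim blast
  then show ?thesis
  proof (rule AE_mp, intro AE_I2 impI)
    fix \<omega> assume w: "\<omega> \<in> space M"
      and "(inj_on fst (N \<omega>) \<and> inj_on snd (N \<omega>)) \<and> N \<omega> \<noteq> {} \<and> (\<forall>p\<in>N \<omega>. fst p < 1)"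
    then have inj: "inj_on fst (N \<omega>)" "inj_on snd (N \<omega>)" and ne: "N \<omega> \<noteq> {}"
      and lt: "\<And>p. p \<in> N \<omega> \<Longrightarrow> fst p < 1" by auto
    obtain b where b: "b \<in> N \<omega>" "\<And>q. q \<in> N \<omega> \<Longrightarrow> q \<noteq> b \<Longrightarrow> snd b < snd q" "best_time (N \<omega>) = fst b"
      using best_time_eq[OF w inj(2) ne] by blast
    show "memoryless_time f (N \<omega>) = best_time (N \<omega>) \<longleftrightarrow>
      (\<exists>p\<in>N \<omega> \<inter> subgraph f. N \<omega> \<inter> blocking f p = {})"
    proof (cases "N \<omega> \<inter> subgraph f = {}")
      case True
      then have "memoryless_time f (N \<omega>) = 1"
        using min_atom_none[of "N \<omega> \<inter> subgraph f" fst]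
        by (simp add: memoryless_time_def memoryless_point_def)
      then show ?thesis using True b lt[OF b(1)] by auto
    next
      case False
      then obtain a where a: "a \<in> N \<omega> \<inter> subgraph f"
        "\<And>q. q \<in> N \<omega> \<inter> subgraph f \<Longrightarrow> q \<noteq> a \<Longrightarrow> fst a < fst q"
        "memoryless_time f (N \<omega>) = fst a"
        using memoryless_time_eq[OF w assms inj(1)] by blast
      have "fst a = fst b \<longleftrightarrow> a = b" using inj(1) a(1) b(1) by (auto simp: inj_on_def)
      moreover have "N \<omega> \<inter> blocking f a = {}" if "a = b"
        using that a(2) b(2) by (force simp: blocking_def)
      moreover have "a = b" if p: "p \<in> N \<omega> \<inter> subgraph f" "N \<omega> \<inter> blocking f p = {}" for p
      proof -
        have "b \<notin> blocking f p" "a \<notin> blocking f p" using p a b by blast+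
        then have "\<not> snd b < snd p" "\<not> fst a < fst p"
          using a(1) b(1) atoms_in_strip[OF w] by (auto simp: blocking_def)
        then show ?thesis using a(2)[OF p(1)] b(2)[of p] p(1) by (metis IntD1)
      qed
      ultimately show ?thesis using a b by metis
    qed
  qed
qed

text \<open>Atoms below a curve arrive before time 1, so the default time cannot be confused with
  the time of a stop.\<close>

lemma AE_none_iff:
  assumes "curve f"
  shows "AE \<omega> in M. memoryless_time f (N \<omega>) = 1 \<longleftrightarrow> N \<omega> \<inter> subgraph f = {}"
  using AE_no_ties
proof (rule AE_mp, intro AE_I2 impI)
  fix \<omega> assume w: "\<omega> \<in> space M" and inj: "inj_on fst (N \<omega>) \<and> inj_on snd (N \<omega>)"
  show "memoryless_time f (N \<omega>) = 1 \<longleftrightarrow> N \<omega> \<inter> subgraph f = {}"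
  proof (cases "N \<omega> \<inter> subgraph f = {}")
    case True
    then show ?thesis
      using min_atom_none[of "N \<omega> \<inter> subgraph f" fst]
      by (simp add: memoryless_time_def memoryless_point_def)
  next
    case False
    then obtain a where "a \<in> N \<omega> \<inter> subgraph f" "memoryless_time f (N \<omega>) = fst a"
      using memoryless_time_eq[OF w assms] inj by blast
    then show ?thesis using False subgraph_time[of a f] by auto
  qed
qed

end

subsection \<open>The success probability as an integral\<close>

context unit_rate_poisson_process
begin

lemma finite_expectation_count:
  assumes "B \<in> sets borel" "bounded B" "B \<subseteq> strip"
  shows "(\<integral>\<^sup>+\<omega>. of_nat (card (N \<omega> \<inter> B)) \<partial>M) < \<infinity>"
proof -
  have "(\<integral>\<^sup>+\<omega>. of_nat (card (N \<omega> \<inter> B)) \<partial>M) = 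
    (\<integral>\<^sup>+\<omega>. indicator {\<omega> \<in> space M. N \<omega> \<inter> {} = {}} \<omega> * of_nat (card (N \<omega> \<inter> B)) \<partial>M)"
    by (intro nn_integral_cong) auto
  also have "\<dots> = emeasure lborel B"
    using nn_integral_count_avoid[of "{}" B] assms by simp
  finally show ?thesis using emeasure_bounded_finite[OF assms(2)] by simp
qed

text \<open>A set of atoms rather than an event, since the Mecke formula computes the expectation of
  its cardinality.\<close>

definition unblocked :: "(real \<Rightarrow> real) \<Rightarrow> (real \<times> real) set \<Rightarrow> 'w \<Rightarrow> (real \<times> real) set" where
  "unblocked f S \<omega> = {p \<in> N \<omega> \<inter> S. N \<omega> \<inter> blocking f p = {}}"

text \<open>The Mecke formula for the functional counting unblocked atoms, obtained by replacing the
  blocking region of an atom by that of the lower left corner of its dyadic cell, which is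
  disjoint from the cell.\<close>

lemma mecke_unblocked:
  assumes "curve f" and S: "S \<in> sets borel" "bounded S" "S \<subseteq> strip" "\<And>p. p \<in> S \<Longrightarrow> fst p < 1"
  shows "(\<lambda>\<omega>. of_nat (card (unblocked f S \<omega>)) :: ennreal) \<in> borel_measurable M"
    and "(\<lambda>p. ennreal (exp (- measure lborel (blocking f p))) * indicator S p) \<in> borel_measurable borel"
    and "(\<integral>\<^sup>+\<omega>. of_nat (card (unblocked f S \<omega>)) \<partial>M) =
      (\<integral>\<^sup>+p. ennreal (exp (- measure lborel (blocking f p))) * indicator S p \<partial>lborel)"
proof -
  interpret curve f by fact
  \<comment> \<open>The sum runs over corners and not over atoms, so that every avoided region is
    deterministic.\<close>
  define X where "X n \<omega> = (\<Sum>v\<in>lower_corner n ` S. indicator {\<omega> \<in> space M. N \<omega> \<inter> blocking f v = {}} \<omega> *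
      of_nat (card (N \<omega> \<inter> {p \<in> S. lower_corner n p = v})) :: ennreal)" for n \<omega>
  define Y where "Y n p = (\<Sum>v\<in>lower_corner n ` S. ennreal (exp (- measure lborel (blocking f v))) *
      indicator {p \<in> S. lower_corner n p = v} p)" for n p
  have fin: "finite (lower_corner n ` S)" for n by (rule finite_lower_corner_image[OF S(2)])
  have cell: "{p \<in> S. lower_corner n p = v} \<in> sets borel" for n v
  proof -
    have "lower_corner n -` {v} \<in> sets borel"
      by (intro measurable_sets_borel[OF lower_corner_measurable]) auto
    then have "S \<inter> lower_corner n -` {v} \<in> sets borel" using S by auto
    then show ?thesis by (simp add: vimage_def Int_def)
  qed
  have cell': "bounded {p \<in> S. lower_corner n p = v}" "{p \<in> S. lower_corner n p = v} \<subseteq> strip" for n v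
    using S by (auto intro: bounded_subset[OF S(2)])
  have v: "bounded (blocking f v)" "blocking f v \<subseteq> strip" if "v \<in> lower_corner n ` S" for n v
  proof -
    have "fst v < 1"
      using that S(4) lower_dyadic_less by (force simp: lower_corner_def intro: less_trans)
    then show "bounded (blocking f v)" by (rule bounded_blocking)
    show "blocking f v \<subseteq> strip" by (auto simp: blocking_def)
  qed
  \<comment> \<open>A point never lies in the blocking region of its own corner; this disjointness
    is what the independence of the two counts requires.\<close>
  have avoid: "blocking f v \<inter> {p \<in> S. lower_corner n p = v} = {}" for n v
  proof (intro equalityI subsetI)
    fix p assume "p \<in> blocking f v \<inter> {p \<in> S. lower_corner n p = v}"
    then have "p \<in> blocking f (lower_corner n p)" by auto
    then show "p \<in> {}"
      using lower_dyadic_less[of n "fst p"] lower_dyadic_less[of n "snd p"]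
      by (simp add: blocking_def lower_corner_def)
  qed simp
  have cnt: "(\<lambda>\<omega>. of_nat (card (N \<omega> \<inter> B)) :: ennreal) \<in> borel_measurable M"
    if "B \<in> sets borel" "bounded B" "B \<subseteq> strip" for B
    using measurable_compose[OF count_measurable[OF that], of of_nat borel] by simp
  have term_meas: "(\<lambda>\<omega>. indicator {\<omega> \<in> space M. N \<omega> \<inter> blocking f v = {}} \<omega> *
      of_nat (card (N \<omega> \<inter> {p \<in> S. lower_corner n p = v})) :: ennreal) \<in> borel_measurable M"
    if "v \<in> lower_corner n ` S" for n v
    using v[OF that] cell cell'
    by (intro borel_measurable_times_ennreal borel_measurable_indicator count_avoid(1) cnt sets_blocking)
  have X_meas: "X n \<in> borel_measurable M" for n
    unfolding X_def by (intro borel_measurable_sum term_meas)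
  have Y_meas: "Y n \<in> borel_measurable borel" for n
    unfolding Y_def using cell
    by (intro borel_measurable_sum borel_measurable_times_ennreal borel_measurable_indicator) auto
  have XY: "(\<integral>\<^sup>+\<omega>. X n \<omega> \<partial>M) = (\<integral>\<^sup>+p. Y n p \<partial>lborel)" for n
  proof -
    have "(\<integral>\<^sup>+\<omega>. X n \<omega> \<partial>M) = (\<Sum>v\<in>lower_corner n ` S.
        \<integral>\<^sup>+\<omega>. indicator {\<omega> \<in> space M. N \<omega> \<inter> blocking f v = {}} \<omega> *
          of_nat (card (N \<omega> \<inter> {p \<in> S. lower_corner n p = v})) \<partial>M)"
      unfolding X_def by (intro nn_integral_sum term_meas)
    also have "\<dots> = (\<Sum>v\<in>lower_corner n ` S.
       ennreal (exp (- measure lborel (blocking f v))) * emeasure lborel {p \<in> S. lower_corner n p = v})"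
      by (intro sum.cong refl nn_integral_count_avoid sets_blocking v cell cell' avoid)
    also have "\<dots> = (\<integral>\<^sup>+p. Y n p \<partial>lborel)"
      unfolding Y_def using cell
      by (subst nn_integral_sum) (auto simp: nn_integral_cmult_indicator)
    finally show ?thesis .
  qed
  have X_eq: "X n \<omega> = of_nat (card {p \<in> N \<omega> \<inter> S. N \<omega> \<inter> blocking f (lower_corner n p) = {}})"
    if w: "\<omega> \<in> space M" for n \<omega>
  proof -
    have fNS: "finite (N \<omega> \<inter> S)" by (rule locally_finite[OF w S(2)])
    have "X n \<omega> = (\<Sum>v\<in>lower_corner n ` S. \<Sum>p\<in>{p \<in> N \<omega> \<inter> S. lower_corner n p = v}.
        of_bool (N \<omega> \<inter> blocking f (lower_corner n p) = {}))"
      unfolding X_def using w by (intro sum.cong) (auto simp: indicator_def Int_def conj_assoc)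
    also have "\<dots> = (\<Sum>p\<in>N \<omega> \<inter> S. of_bool (N \<omega> \<inter> blocking f (lower_corner n p) = {}))"
      using fNS fin by (intro sum.group) auto
    also have "\<dots> = of_nat (card {p \<in> N \<omega> \<inter> S. N \<omega> \<inter> blocking f (lower_corner n p) = {}})"
      using fNS by (subst sum_of_bool_eq) (auto simp: Int_def)
    finally show ?thesis .
  qed
  have Y_eq: "Y n p = ennreal (exp (- measure lborel (blocking f (lower_corner n p)))) * indicator S p" for n p
  proof (cases "p \<in> S")
    case True
    have "Y n p = (\<Sum>v\<in>{lower_corner n p}. ennreal (exp (- measure lborel (blocking f v))) *
        indicator {p \<in> S. lower_corner n p = v} p)"
      unfolding Y_def using True fin by (intro sum.mono_neutral_right) (auto simp: indicator_def)
    then show ?thesis using True by simp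
  qed (simp add: Y_def)
  have X_lim: "(\<lambda>n. X n \<omega>) \<longlonglongrightarrow> of_nat (card (unblocked f S \<omega>))" if w: "\<omega> \<in> space M" for \<omega>
  proof -
    have fNS: "finite (N \<omega> \<inter> S)" by (rule locally_finite[OF w S(2)])
    have "eventually (\<lambda>n. N \<omega> \<inter> blocking f (lower_corner n p) = {} \<longleftrightarrow> N \<omega> \<inter> blocking f p = {}) sequentially"
      if p: "p \<in> N \<omega> \<inter> S" for p
    proof -
      have "finite (N \<omega> \<inter> blocking f p)"
        using p S(4) by (intro locally_finite[OF w] bounded_blocking) auto
      \<comment> \<open>The full region holds finitely many atoms, so their memberships eventually
        all agree at once, and \<open>X n\<close> is eventually constant on each
        realisation.\<close>
      then have "eventually (\<lambda>n. \<forall>q\<in>N \<omega> \<inter> blocking f p. q \<in> blocking f (lower_corner n p) \<longleftrightarrow> q \<in> blocking f p) sequentially"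
        by (intro eventually_ball_finite ballI eventually_mem_blocking_lower_corner)
      then show ?thesis
        by eventually_elim (use blocking_lower_corner_subset in blast)
    qed
    then have "eventually (\<lambda>n. \<forall>p\<in>N \<omega> \<inter> S. N \<omega> \<inter> blocking f (lower_corner n p) = {} \<longleftrightarrow> N \<omega> \<inter> blocking f p = {}) sequentially"
      using fNS by (intro eventually_ball_finite) auto
    then have "eventually (\<lambda>n. X n \<omega> = of_nat (card (unblocked f S \<omega>))) sequentially"
    proof eventually_elim
      case (elim n)
      then have "{p \<in> N \<omega> \<inter> S. N \<omega> \<inter> blocking f (lower_corner n p) = {}} = unblocked f S \<omega>"
        unfolding unblocked_def by blast
      then show ?case using X_eq[OF w] by simp
    qed
    then show ?thesis by (rule tendsto_eventually)
  qed
  have Y_lim: "(\<lambda>n. Y n p) \<longlonglongrightarrow> ennreal (exp (- measure lborel (blocking f p))) * indicator S p" for p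
  proof (cases "p \<in> S")
    case True
    then show ?thesis
      unfolding Y_eq using S(4)[OF True]
      by (auto intro!: tendsto_ennrealI tendsto_intros measure_blocking_lower_corner_tendsto)
  qed (simp add: Y_eq)
  show mX: "(\<lambda>\<omega>. of_nat (card (unblocked f S \<omega>)) :: ennreal) \<in> borel_measurable M"
    by (rule borel_measurable_LIMSEQ_order[OF X_lim X_meas])
  show mY: "(\<lambda>p. ennreal (exp (- measure lborel (blocking f p))) * indicator S p) \<in> borel_measurable borel"
    by (rule borel_measurable_LIMSEQ_order[OF Y_lim Y_meas])
  have 1: "(\<lambda>n. \<integral>\<^sup>+\<omega>. X n \<omega> \<partial>M) \<longlonglongrightarrow> (\<integral>\<^sup>+\<omega>. of_nat (card (unblocked f S \<omega>)) \<partial>M)"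
  proof (rule nn_integral_dominated_convergence[where w = "\<lambda>\<omega>. of_nat (card (N \<omega> \<inter> S))"])
    \<comment> \<open>\<open>X n\<close> counts some of the atoms in \<open>S\<close>, whose total
      number has finite expectation.\<close>
    show "AE \<omega> in M. X n \<omega> \<le> of_nat (card (N \<omega> \<inter> S))" for n
      using locally_finite[OF _ S(2)]
      by (intro AE_I2) (auto simp: X_eq intro!: card_mono)
  qed (use X_meas mX X_lim S cnt finite_expectation_count in auto)
  have 2: "(\<lambda>n. \<integral>\<^sup>+p. Y n p \<partial>lborel) \<longlonglongrightarrow>
    (\<integral>\<^sup>+p. ennreal (exp (- measure lborel (blocking f p))) * indicator S p \<partial>lborel)"
  proof (rule nn_integral_dominated_convergence[where w = "indicator S"])
    show "AE p in lborel. Y n p \<le> indicator S p" for n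
      by (intro AE_I2) (auto simp: Y_eq indicator_def)
  qed (use Y_meas mY Y_lim S emeasure_bounded_finite[OF S(2)] in auto)
  show "(\<integral>\<^sup>+\<omega>. of_nat (card (unblocked f S \<omega>)) \<partial>M) =
      (\<integral>\<^sup>+p. ennreal (exp (- measure lborel (blocking f p))) * indicator S p \<partial>lborel)"
    using LIMSEQ_unique[OF 1] 2 unfolding XY by blast
qed

text \<open>Counts are available on bounded sets only, and the subgraph may be unbounded near time
  1, so it is approached through its parts up to times that increase to 1.\<close>

lemma exhaust_subgraph:
  assumes "curve f"
  defines "S \<equiv> \<lambda>k. {p \<in> subgraph f. fst p \<le> 1 - 1 / (real k + 2)}"
  shows "S k \<in> sets borel" "bounded (S k)" "S k \<subseteq> strip" "p \<in> S k \<Longrightarrow> fst p < 1"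
    "incseq S" "(\<Union>k. S k) = subgraph f"
proof -
  interpret curve f by fact
  have "S k = subgraph f \<inter> {p. fst p \<le> 1 - 1 / (real k + 2)}" by (auto simp: S_def)
  moreover have "closed {p :: real \<times> real. fst p \<le> 1 - 1 / (real k + 2)}"
    by (intro closed_Collect_le continuous_intros)
  ultimately show "S k \<in> sets borel" by (metis borel_closed sets.Int sets_subgraph)
  show "bounded (S k)" unfolding S_def by (rule bounded_subgraph) auto
  show "S k \<subseteq> strip" using subgraph_strip by (auto simp: S_def)
  show "p \<in> S k \<Longrightarrow> fst p < 1" using subgraph_time[of p f] by (simp add: S_def)
  show "incseq S"
    by (auto simp: S_def incseq_def elim!: order_trans intro!: divide_left_mono)
  show "(\<Union>k. S k) = subgraph f"
  proof (intro equalityI subsetI)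
    fix p assume p: "p \<in> subgraph f"
    then have "0 < 1 - fst p" using subgraph_time by fastforce
    then obtain k where "inverse (real (Suc k)) < 1 - fst p" using reals_Archimedean by blast
    moreover have "1 / (real k + 2) \<le> inverse (real (Suc k))" by (simp add: divide_simps)
    ultimately have "p \<in> S k" using p by (simp add: S_def)
    then show "p \<in> (\<Union>k. S k)" by blast
  qed (auto simp: S_def)
qed

lemma success_event:
  assumes "curve f"
  shows "{\<omega> \<in> space M. memoryless_time f (N \<omega>) = best_time (N \<omega>)} \<in> events"
  using best_time_measurable memoryless_time_measurable[OF assms] by measurable

text \<open>At most one atom of the subgraph is unblocked, so the number of such atoms is almost
  surely the indicator of success, and the Mecke formula gives its expectation. Monotone convergence
  passes from the bounded parts to the whole subgraph.\<close>

lemma success_prob_eq_integral: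
  assumes "curve f"
  shows "(\<lambda>p. ennreal (exp (- measure lborel (blocking f p))) * indicator (subgraph f) p) \<in> borel_measurable borel"
    and "ennreal (success_prob M N f) =
      (\<integral>\<^sup>+p. ennreal (exp (- measure lborel (blocking f p))) * indicator (subgraph f) p \<partial>lborel)"
proof -
  let ?S = "\<lambda>k. {p \<in> subgraph f. fst p \<le> 1 - 1 / (real k + 2)}"
  let ?e = "\<lambda>p. ennreal (exp (- measure lborel (blocking f p)))"
  note S = exhaust_subgraph[OF assms]
  have mk: "(\<lambda>\<omega>. of_nat (card (unblocked f (?S k) \<omega>)) :: ennreal) \<in> borel_measurable M"
    "(\<lambda>p. ?e p * indicator (?S k) p) \<in> borel_measurable borel"
    "(\<integral>\<^sup>+\<omega>. of_nat (card (unblocked f (?S k) \<omega>)) \<partial>M) = (\<integral>\<^sup>+p. ?e p * indicator (?S k) p \<partial>lborel)" for k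
    by (rule mecke_unblocked[OF assms S(1-3)], erule S(4))+
  have SUPY: "(\<Squnion>k. ?e p * indicator (?S k) p) = ?e p * indicator (subgraph f) p" for p
  proof (cases "p \<in> subgraph f")
    case True
    then obtain k0 where "p \<in> ?S k0" using S(6) by blast
    then show ?thesis
      by (intro antisym SUP_least SUP_upper2[of k0]) (auto simp: indicator_def)
  qed simp
  have incY: "incseq (\<lambda>k p. ?e p * indicator (?S k) p)"
    unfolding incseq_def
  proof (intro allI impI le_funI mult_left_mono)
    fix m n :: nat and p assume "m \<le> n"
    then have "?S m \<subseteq> ?S n" by (rule incseqD[OF S(5)])
    then show "indicator (?S m) p \<le> (indicator (?S n) p :: ennreal)" by (auto simp: indicator_def)
  qed simp
  show m: "(\<lambda>p. ?e p * indicator (subgraph f) p) \<in> borel_measurable borel"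
    unfolding SUPY[symmetric] using mk(2) by (intro borel_measurable_SUP) auto
  have "ennreal (success_prob M N f) =
    (\<integral>\<^sup>+\<omega>. indicator {\<omega> \<in> space M. memoryless_time f (N \<omega>) = best_time (N \<omega>)} \<omega> \<partial>M)"
    using success_event[OF assms] by (simp add: success_prob_def emeasure_eq_measure)
  also have "\<dots> = (\<integral>\<^sup>+\<omega>. (\<Squnion>k. of_nat (card (unblocked f (?S k) \<omega>))) \<partial>M)"
    using AE_success_iff[OF assms]
  proof (intro nn_integral_cong_AE, elim AE_mp, intro AE_I2 impI)
    fix \<omega> assume w: "\<omega> \<in> space M" and iff: "memoryless_time f (N \<omega>) = best_time (N \<omega>) \<longleftrightarrow>
      (\<exists>p\<in>N \<omega> \<inter> subgraph f. N \<omega> \<inter> blocking f p = {})"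
    \<comment> \<open>Two atoms of the subgraph that do not block each other are ordered neither by
      time nor by score, so both coordinates agree.\<close>
    have uniq: "p = q" if "p \<in> unblocked f (subgraph f) \<omega>" "q \<in> unblocked f (subgraph f) \<omega>" for p q
    proof -
      have "p \<notin> blocking f q" "q \<notin> blocking f p" using that by (auto simp: unblocked_def)
      then show ?thesis
        using that atoms_in_strip[OF w] by (auto simp: unblocked_def blocking_def prod_eq_iff)
    qed
    have U: "unblocked f (?S k) \<omega> \<subseteq> unblocked f (subgraph f) \<omega>" for k by (auto simp: unblocked_def)
    show "indicator {\<omega> \<in> space M. memoryless_time f (N \<omega>) = best_time (N \<omega>)} \<omega> =
      (\<Squnion>k. of_nat (card (unblocked f (?S k) \<omega>)) :: ennreal)"
    proof (cases "unblocked f (subgraph f) \<omega> = {}")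
      case True
      then have "unblocked f (?S k) \<omega> = {}" for k using U by blast
      moreover have "\<not> (memoryless_time f (N \<omega>) = best_time (N \<omega>))"
        using iff True by (auto simp: unblocked_def)
      ultimately show ?thesis by simp
    next
      case False
      then obtain p where p: "p \<in> unblocked f (subgraph f) \<omega>" by blast
      then have one: "unblocked f (subgraph f) \<omega> = {p}" using uniq by blast
      have "p \<in> subgraph f" using p by (simp add: unblocked_def)
      then obtain k0 where "p \<in> ?S k0" using S(6) by blast
      then have "unblocked f (?S k0) \<omega> = {p}" using p U[of k0] one by (auto simp: unblocked_def)
      then have "1 \<le> (\<Squnion>k. of_nat (card (unblocked f (?S k) \<omega>)) :: ennreal)"
        by (intro SUP_upper2[of k0]) auto
      moreover have "(\<Squnion>k. of_nat (card (unblocked f (?S k) \<omega>)) :: ennreal) \<le> 1"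
      proof (rule SUP_least)
        fix k
        have "card (unblocked f (?S k) \<omega>) \<le> card {p}" using U[of k] one by (intro card_mono) auto
        then show "(of_nat (card (unblocked f (?S k) \<omega>)) :: ennreal) \<le> 1"
          using of_nat_mono[where 'a = ennreal] by fastforce
      qed
      ultimately have "(\<Squnion>k. of_nat (card (unblocked f (?S k) \<omega>)) :: ennreal) = 1"
        by (intro antisym)
      moreover have "memoryless_time f (N \<omega>) = best_time (N \<omega>)"
        using iff p by (auto simp: unblocked_def)
      ultimately show ?thesis using w by simp
    qed
  qed
  \<comment> \<open>Outside the sample space the atoms need not be locally finite, and
    \<open>card\<close> of an infinite set is 0; the indicator makes the sequence monotone
    everywhere.\<close>
  also have "\<dots> = (\<integral>\<^sup>+\<omega>. (\<Squnion>k. of_nat (card (unblocked f (?S k) \<omega>)) * indicator (space M) \<omega>) \<partial>M)"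
    by (intro nn_integral_cong) simp
  also have "\<dots> = (\<Squnion>k. \<integral>\<^sup>+\<omega>. of_nat (card (unblocked f (?S k) \<omega>)) * indicator (space M) \<omega> \<partial>M)"
  proof (rule nn_integral_monotone_convergence_SUP)
    show "incseq (\<lambda>k \<omega>. of_nat (card (unblocked f (?S k) \<omega>)) * indicator (space M) \<omega> :: ennreal)"
    proof (intro incseq_SucI le_funI)
      fix k \<omega>
      have "?S k \<subseteq> ?S (Suc k)" using S(5) by (auto simp: incseq_Suc_iff)
      then have "unblocked f (?S k) \<omega> \<subseteq> unblocked f (?S (Suc k)) \<omega>" unfolding unblocked_def by blast
      moreover have "finite (unblocked f (?S (Suc k)) \<omega>)" if "\<omega> \<in> space M"
        using locally_finite[OF that S(2)[of "Suc k"]] by (rule rev_finite_subset) (auto simp: unblocked_def)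
      ultimately have "card (unblocked f (?S k) \<omega>) \<le> card (unblocked f (?S (Suc k)) \<omega>)" if "\<omega> \<in> space M"
        using that by (intro card_mono)
      then show "of_nat (card (unblocked f (?S k) \<omega>)) * indicator (space M) \<omega>
        \<le> (of_nat (card (unblocked f (?S (Suc k)) \<omega>)) * indicator (space M) \<omega> :: ennreal)"
        by (cases "\<omega> \<in> space M") simp_all
    qed
  qed (intro borel_measurable_times_ennreal mk(1) borel_measurable_indicator sets.top)
  also have "\<dots> = (\<Squnion>k. \<integral>\<^sup>+p. ?e p * indicator (?S k) p \<partial>lborel)"
    using mk(3) by (simp cong: nn_integral_cong)
  also have "\<dots> = (\<integral>\<^sup>+p. (\<Squnion>k. ?e p * indicator (?S k) p) \<partial>lborel)"
    using incY mk(2)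
    by (intro nn_integral_monotone_convergence_SUP[symmetric]) auto
  also have "\<dots> = (\<integral>\<^sup>+p. ?e p * indicator (subgraph f) p \<partial>lborel)"
    unfolding SUPY ..
  finally show "ennreal (success_prob M N f) = (\<integral>\<^sup>+p. ?e p * indicator (subgraph f) p \<partial>lborel)" .
qed

text \<open>The void probability of a set that has finite area but may be unbounded, obtained as the
  limit of those of its bounded parts.\<close>

lemma prob_none:
  assumes "curve f" and fin: "emeasure lborel (subgraph f) < \<infinity>"
  shows "prob {\<omega> \<in> space M. memoryless_time f (N \<omega>) = 1} = exp (- measure lborel (subgraph f))"
proof -
  let ?S = "\<lambda>k. {p \<in> subgraph f. fst p \<le> 1 - 1 / (real k + 2)}"
  note S = exhaust_subgraph[OF assms(1)]
  let ?E = "\<lambda>k. {\<omega> \<in> space M. N \<omega> \<inter> ?S k = {}}"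
  have E: "?E k \<in> events" "prob (?E k) = exp (- measure lborel (?S k))" for k
    using count_avoid[OF S(1-3)] by auto
  have Eq: "(\<Inter>k. ?E k) = {\<omega> \<in> space M. N \<omega> \<inter> subgraph f = {}}"
    using S(6) by blast
  have "decseq ?E" using S(5) unfolding decseq_def incseq_def by blast
  then have "(\<lambda>k. prob (?E k)) \<longlonglongrightarrow> prob (\<Inter>k. ?E k)"
    using E by (intro finite_Lim_measure_decseq) auto
  moreover have "(\<lambda>k. prob (?E k)) \<longlonglongrightarrow> exp (- measure lborel (subgraph f))"
  proof -
    have "(\<lambda>k. measure lborel (?S k)) \<longlonglongrightarrow> measure lborel (\<Union>k. ?S k)"
      using fin S by (intro Lim_measure_incseq) (auto simp: S(6))
    then show ?thesis unfolding E(2) S(6) by (intro tendsto_intros)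
  qed
  ultimately have "prob {\<omega> \<in> space M. N \<omega> \<inter> subgraph f = {}} = exp (- measure lborel (subgraph f))"
    unfolding Eq by (rule LIMSEQ_unique)
  moreover have "prob {\<omega> \<in> space M. memoryless_time f (N \<omega>) = 1} = prob {\<omega> \<in> space M. N \<omega> \<inter> subgraph f = {}}"
  proof (rule finite_measure_eq_AE)
    show "{\<omega> \<in> space M. memoryless_time f (N \<omega>) = 1} \<in> events"
      using memoryless_time_measurable[OF assms(1)] by measurable
    show "{\<omega> \<in> space M. N \<omega> \<inter> subgraph f = {}} \<in> events"
      unfolding Eq[symmetric] using E by auto
    show "AE \<omega> in M. (\<omega> \<in> {\<omega> \<in> space M. memoryless_time f (N \<omega>) = 1}) =
      (\<omega> \<in> {\<omega> \<in> space M. N \<omega> \<inter> subgraph f = {}})"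
      using AE_none_iff[OF assms(1)] by eventually_elim auto
  qed
  ultimately show ?thesis by simp
qed

end

subsection \<open>Areas of blocking regions\<close>

lemma ennreal_set_integral:
  fixes h :: "'a \<Rightarrow> real"
  assumes "set_integrable M A h" "\<And>x. x \<in> A \<Longrightarrow> 0 \<le> h x"
  shows "ennreal (LINT x:A|M. h x) = (\<integral>\<^sup>+x. ennreal (h x) * indicator A x \<partial>M)"
proof -
  have "(\<integral>\<^sup>+x. ennreal (indicator A x *\<^sub>R h x) \<partial>M) = ennreal (LINT x:A|M. h x)"
    unfolding set_lebesgue_integral_def
    by (rule nn_integral_eq_integral) (use assms in \<open>auto simp: set_integrable_def indicator_def\<close>)
  moreover have "ennreal (indicator A x *\<^sub>R h x) = ennreal (h x) * indicator A x" for x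
    by (simp add: indicator_def)
  ultimately show ?thesis by simp
qed

text \<open>Real-valued counterpart of \<open>cumulative\<close>, suited to differences and
  exponentials; it is meant for times t up to which h is integrable.\<close>

definition cum :: "(real \<Rightarrow> real) \<Rightarrow> real \<Rightarrow> real" where
  "cum h t = (LINT s:{0..t}|lborel. h s)"

lemma cum_measurable[measurable]:
  assumes [measurable]: "h \<in> borel_measurable borel"
  shows "cum h \<in> borel_measurable borel"
proof -
  have "(\<lambda>t. \<integral>s. indicator {q. 0 \<le> snd q \<and> snd q \<le> fst q} (t, s) *\<^sub>R h s \<partial>lborel) \<in> borel_measurable borel"
    by measurable
  moreover have "cum h = (\<lambda>t. \<integral>s. indicator {q. 0 \<le> snd q \<and> snd q \<le> fst q} (t, s) *\<^sub>R h s \<partial>lborel)"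
    by (auto simp: cum_def fun_eq_iff set_lebesgue_integral_def indicator_def intro!: Bochner_Integration.integral_cong)
  ultimately show ?thesis by simp
qed

lemma cum_split:
  assumes "set_integrable lborel {0..t} h" "0 \<le> s" "s \<le> t"
  shows "cum h t = cum h s + (LINT x:{s<..t}|lborel. h x)" "set_integrable lborel {s<..t} h"
proof -
  have "{0..t} = {0..s} \<union> {s<..t}" using assms by auto
  moreover have "set_integrable lborel {0..s} h" "set_integrable lborel {s<..t} h"
    using assms by (auto intro: set_integrable_subset)
  ultimately show "cum h t = cum h s + (LINT x:{s<..t}|lborel. h x)" "set_integrable lborel {s<..t} h"
    unfolding cum_def by (auto intro!: set_integral_Un)
qed

lemma set_integrable_lborel_const: "bounded A \<Longrightarrow> A \<in> sets borel \<Longrightarrow> set_integrable lborel A (\<lambda>x. c::real)"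
  for A :: "real set"
  unfolding set_integrable_def using emeasure_bounded_finite[of A]
  by (intro integrable_scaleR_left integrable_real_indicator) auto

lemma cum_const: "0 \<le> t \<Longrightarrow> cum (\<lambda>s. c) t = c * t"
  unfolding cum_def by (simp add: set_integral_const[OF _ emeasure_bounded_finite[THEN less_imp_neq]])

lemma set_integral_Ioc_const: "s \<le> t \<Longrightarrow> (LINT x:{s<..t}|lborel. c) = c * (t - s)" for s t c :: real
  by (simp add: set_integral_const[OF _ emeasure_bounded_finite[THEN less_imp_neq]])

lemma cum_mono_on:
  assumes "set_integrable lborel {0..t} h" "set_integrable lborel {0..t} k" "\<And>s. 0 \<le> s \<Longrightarrow> s \<le> t \<Longrightarrow> h s \<le> k s"
  shows "cum h t \<le> cum k t"
  unfolding cum_def using assms by (intro set_integral_mono) auto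

lemma cum_cong: "(\<And>s. 0 \<le> s \<Longrightarrow> s \<le> t \<Longrightarrow> h s = k s) \<Longrightarrow> cum h t = cum k t"
  unfolding cum_def by (intro set_lebesgue_integral_cong) auto

lemma cum_add:
  assumes "set_integrable lborel {0..t} h" "set_integrable lborel {0..t} k"
  shows "cum (\<lambda>s. h s + k s) t = cum h t + cum k t"
  unfolding cum_def using assms by (rule set_integral_add)

lemma cum_diff:
  assumes "set_integrable lborel {0..t} h" "set_integrable lborel {0..t} k"
  shows "cum (\<lambda>s. h s - k s) t = cum h t - cum k t"
  unfolding cum_def using assms by (rule set_integral_diff)

lemma ennreal_cum:
  assumes "set_integrable lborel {0..t} h" "\<And>s. 0 \<le> s \<Longrightarrow> s \<le> t \<Longrightarrow> 0 \<le> h s"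
  shows "ennreal (cum h t) = (\<integral>\<^sup>+s. ennreal (h s) * indicator {0..t} s \<partial>lborel)"
  unfolding cum_def using assms by (intro ennreal_set_integral) auto

text \<open>Measurability on the whole line keeps indicators out of the integrands below. It is
  achieved at the end by setting the curve to 0 outside [0,1), which changes neither the subgraph
  nor the stopping rule.\<close>

locale borel_curve = curve +
  assumes borel[measurable]: "f \<in> borel_measurable borel"
begin

lemma integrable_upto: "t < 1 \<Longrightarrow> set_integrable lborel {0..t} f"
  unfolding set_integrable_def
proof (rule Bochner_Integration.integrable_bound)
  show "integrable lborel (\<lambda>s. indicator {0..t} s *\<^sub>R f t)"
    using set_integrable_lborel_const[of "{0..t}" "f t"] by (simp add: set_integrable_def)
  show "AE s in lborel. norm (indicator {0..t} s *\<^sub>R f s) \<le> norm (indicator {0..t} s *\<^sub>R f t)" if "t < 1"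
    using that by (intro AE_I2) (auto simp: indicator_def abs_of_nonneg nonneg intro!: mono)
qed measurable

lemma cum_nonneg: "t < 1 \<Longrightarrow> 0 \<le> cum f t"
  unfolding cum_def set_lebesgue_integral_def
  by (intro Bochner_Integration.integral_nonneg) (auto simp: indicator_def nonneg)

lemma cum_mono: "0 \<le> s \<Longrightarrow> s \<le> t \<Longrightarrow> t < 1 \<Longrightarrow> cum f s \<le> cum f t"
  using cum_split[OF integrable_upto, of t s] nonneg
  by (auto simp: set_lebesgue_integral_def indicator_def intro!: Bochner_Integration.integral_nonneg)

text \<open>This maximum is the height up to which the times before t are blocked for an atom (t,
  x), so the facts on curves are wanted for it as well.\<close>

lemma curve_max: "borel_curve (\<lambda>s. max (f s) x)"
proof unfold_locales
  show "0 \<le> max (f t) x" if "0 \<le> t" "t < 1" for t using nonneg[OF that] by simp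
  show "max (f s) x \<le> max (f t) x" if "0 \<le> s" "s \<le> t" "t < 1" for s t using mono[OF that] by auto
qed measurable

text \<open>Computed by vertical sections: before t the section is blocked up to the larger of f and
  x, after t only up to x.\<close>

lemma emeasure_blocking:
  assumes t: "0 \<le> t" "t < 1" and x: "0 \<le> x"
  shows "emeasure lborel (blocking f (t, x)) = ennreal (cum (\<lambda>s. max (f s) x) t + (1 - t) * x)"
proof -
  interpret mx: borel_curve "\<lambda>s. max (f s) x" by (rule curve_max)
  have "emeasure lborel (blocking f (t, x)) = emeasure (lborel \<Otimes>\<^sub>M lborel) (blocking f (t, x))"
    by (simp add: lborel_prod)
  also have "\<dots> = (\<integral>\<^sup>+s. emeasure lborel (Pair s -` blocking f (t, x)) \<partial>lborel)"
    by (intro lborel.emeasure_pair_measure_alt) (simp only: lborel_prod sets_lborel sets_blocking)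
  also have "\<dots> = (\<integral>\<^sup>+s. ennreal (max (f s) x) * indicator {0..t} s + ennreal x * indicator {t<..1} s \<partial>lborel)"
  proof (rule nn_integral_cong_AE)
    \<comment> \<open>At s = t the section has height x and not \<open>max (f t) x\<close>, but a
      single time carries no area.\<close>
    show "AE s in lborel. emeasure lborel (Pair s -` blocking f (t, x)) =
      ennreal (max (f s) x) * indicator {0..t} s + ennreal x * indicator {t<..1} s"
      using AE_lborel_singleton[of t]
    proof eventually_elim
      fix s assume "s \<noteq> t"
      then consider "s \<notin> {0..1}" | "0 \<le> s" "s < t" | "t < s" "s \<le> 1" by fastforce
      then show "emeasure lborel (Pair s -` blocking f (t, x)) =
        ennreal (max (f s) x) * indicator {0..t} s + ennreal x * indicator {t<..1} s"
      proof cases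
        case 1
        then have "Pair s -` blocking f (t, x) = {}" by (auto simp: blocking_def strip_def)
        then show ?thesis using 1 t by (auto simp: indicator_def)
      next
        case 2
        have "Pair s -` blocking f (t, x) = (if x \<le> f s then {0..f s} else {0..<x})"
          using 2 t by (auto simp: blocking_def strip_def subgraph_def)
        then show ?thesis using 2 t x nonneg[of s] by (auto simp: max_def)
      next
        case 3
        have "Pair s -` blocking f (t, x) = {0..<x}"
          using 3 t by (auto simp: blocking_def strip_def)
        then show ?thesis using 3 t x by auto
      qed
    qed
  qed
  also have "\<dots> = (\<integral>\<^sup>+s. ennreal (max (f s) x) * indicator {0..t} s \<partial>lborel) +
      (\<integral>\<^sup>+s. ennreal x * indicator {t<..1} s \<partial>lborel)"
    by (intro nn_integral_add) auto
  also have "(\<integral>\<^sup>+s. ennreal (max (f s) x) * indicator {0..t} s \<partial>lborel) = ennreal (cum (\<lambda>s. max (f s) x) t)"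
    using mx.integrable_upto[OF t(2)] t x by (intro ennreal_cum[symmetric]) auto
  also have "(\<integral>\<^sup>+s. ennreal x * indicator {t<..1} s \<partial>lborel) = ennreal ((1 - t) * x)"
    using t x by (simp add: nn_integral_cmult_indicator ennreal_mult[symmetric] mult.commute)
  finally show ?thesis
    using mx.cum_nonneg[OF t(2)] t x by (simp add: ennreal_plus)
qed

text \<open>The integrand \<open>exp (- A f t x)\<close> of the success probability. For x \<le> f t
  it is the probability that no atom prevents (t, x) from being both the first below the curve and
  the best.\<close>

definition win_density :: "real \<Rightarrow> real \<Rightarrow> real" where
  "win_density t x = exp (- (cum (\<lambda>s. max (f s) x) t + (1 - t) * x))"

lemma exp_measure_blocking:
  assumes "0 \<le> t" "t < 1" "0 \<le> x"
  shows "exp (- measure lborel (blocking f (t, x))) = win_density t x"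
proof -
  interpret mx: borel_curve "\<lambda>s. max (f s) x" by (rule curve_max)
  have "0 \<le> cum (\<lambda>s. max (f s) x) t + (1 - t) * x"
    using mx.cum_nonneg[OF assms(2)] assms by simp
  then show ?thesis
    unfolding win_density_def measure_def emeasure_blocking[OF assms] by simp
qed

end

text \<open>Both success probabilities contain the atoms below \<open>lo\<close>, weighted as for
  \<open>hi\<close>. Beyond these, \<open>hi\<close> wins at atoms of the layer between the curves
  (\<open>loss\<close>), while \<open>lo\<close> wins more often below \<open>lo\<close>, because
  atoms of the layer no longer stop it earlier (\<open>gain\<close>). The additive form avoids
  subtraction of infinite values; the second claim serves to show that \<open>gain\<close> is
  finite.\<close>

lemma (in unit_rate_poisson_process) exchange:
  fixes lo hi :: "real \<Rightarrow> real"
  assumes "borel_curve lo" "borel_curve hi" and le: "\<And>t. 0 \<le> t \<Longrightarrow> t < 1 \<Longrightarrow> lo t \<le> hi t"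
  defines "loss \<equiv> \<integral>\<^sup>+t. \<integral>\<^sup>+x. ennreal (borel_curve.win_density hi t x) * indicator {lo t<..hi t} x * indicator {0..<1} t \<partial>lborel \<partial>lborel"
    and "gain \<equiv> \<integral>\<^sup>+t. \<integral>\<^sup>+x. ennreal (borel_curve.win_density lo t x - borel_curve.win_density hi t x)
        * indicator {0..lo t} x * indicator {0..<1} t \<partial>lborel \<partial>lborel"
  shows "ennreal (success_prob M N hi) + gain = ennreal (success_prob M N lo) + loss"
    and "gain \<le> ennreal (success_prob M N lo)"
proof -
  interpret lo: borel_curve lo by fact
  interpret hi: borel_curve hi by fact
  let ?W = "\<lambda>h p. ennreal (exp (- measure lborel (blocking h p)))"
  have sub: "subgraph lo \<subseteq> subgraph hi"
    using le by (fastforce simp: subgraph_def)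
  have Wle: "?W hi p \<le> ?W lo p" if "p \<in> subgraph lo" for p
  proof -
    have "fst p < 1" using subgraph_time[OF that] .
    have S: "blocking lo p \<subseteq> blocking hi p" using sub by (auto simp: blocking_def)
    have "measure lborel (blocking lo p) \<le> measure lborel (blocking hi p)"
      using emeasure_bounded_finite[OF hi.bounded_blocking[OF \<open>fst p < 1\<close>]]
      by (intro measure_mono_fmeasurable fmeasurableI S) auto
    then show ?thesis by (auto intro!: ennreal_leI)
  qed
  note mlo[measurable] = success_prob_eq_integral(1)[OF lo.curve_axioms]
  note mhi[measurable] = success_prob_eq_integral(1)[OF hi.curve_axioms]
  note [measurable] = lo.sets_subgraph hi.sets_subgraph
  define H where "H p = ?W hi p * indicator (subgraph lo) p" for p
  define R where "R p = ?W hi p * indicator (subgraph hi - subgraph lo) p" for p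
  define D where "D p = ?W lo p * indicator (subgraph lo) p - H p" for p
  \<comment> \<open>Measurability is known only for the weight of \<open>hi\<close> multiplied by
    the indicator of its own subgraph, so \<open>H\<close> and \<open>R\<close> are expressed as
    restrictions of that product.\<close>
  have H_eq: "H = (\<lambda>p. (?W hi p * indicator (subgraph hi) p) * indicator (subgraph lo) p)"
    using sub by (auto simp: H_def fun_eq_iff indicator_def)
  have R_eq: "R = (\<lambda>p. (?W hi p * indicator (subgraph hi) p) * indicator (- subgraph lo) p)"
    by (auto simp: R_def fun_eq_iff indicator_def)
  have [measurable]: "H \<in> borel_measurable borel" "R \<in> borel_measurable borel" "D \<in> borel_measurable borel"
    unfolding H_eq R_eq D_def by measurable
  have 1: "ennreal (success_prob M N hi) = (\<integral>\<^sup>+p. H p \<partial>lborel) + (\<integral>\<^sup>+p. R p \<partial>lborel)"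
    unfolding success_prob_eq_integral(2)[OF hi.curve_axioms]
    by (subst nn_integral_add[symmetric]) 
       (use sub in \<open>auto simp: H_def R_def indicator_def intro!: nn_integral_cong\<close>)
  have 2: "ennreal (success_prob M N lo) = (\<integral>\<^sup>+p. H p \<partial>lborel) + (\<integral>\<^sup>+p. D p \<partial>lborel)"
    unfolding success_prob_eq_integral(2)[OF lo.curve_axioms]
  proof (subst nn_integral_add[symmetric])
    have "?W lo p * indicator (subgraph lo) p = H p + D p" for p
    proof (cases "p \<in> subgraph lo")
      case True
      have "?W hi p + (?W lo p - ?W hi p) = ?W lo p"
        by (rule trans[OF add.commute diff_add_cancel_ennreal[OF Wle[OF True]]])
      then show ?thesis by (simp only: D_def H_def indicator_simps(1)[OF True] mult_1_right)
    qed (simp add: D_def H_def)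
    then show "(\<integral>\<^sup>+p. ?W lo p * indicator (subgraph lo) p \<partial>lborel) = (\<integral>\<^sup>+p. H p + D p \<partial>lborel)" by simp
  qed auto
  have fst: "(\<integral>\<^sup>+p. F p \<partial>lborel) = (\<integral>\<^sup>+t. \<integral>\<^sup>+x. F (t, x) \<partial>lborel \<partial>lborel)"
    if "F \<in> borel_measurable borel" for F :: "real \<times> real \<Rightarrow> ennreal"
    using lborel.nn_integral_fst[of F lborel] that by (simp add: lborel_prod)
  have R_pt: "R (t, x) = ennreal (hi.win_density t x) * indicator {lo t<..hi t} x * indicator {0..<1} t" for t x
    using lo.nonneg[of t] by (auto simp: R_def indicator_def subgraph_def hi.exp_measure_blocking)
  have "(\<integral>\<^sup>+p. R p \<partial>lborel) = loss"
    unfolding loss_def by (subst fst) (simp_all add: R_pt)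
  moreover have "(\<integral>\<^sup>+p. D p \<partial>lborel) = gain"
    unfolding gain_def
    by (subst fst)
       (auto simp: D_def H_def indicator_def subgraph_def hi.exp_measure_blocking lo.exp_measure_blocking
         hi.win_density_def ennreal_minus intro!: nn_integral_cong)
  ultimately show "ennreal (success_prob M N hi) + gain = ennreal (success_prob M N lo) + loss"
    "gain \<le> ennreal (success_prob M N lo)"
    unfolding 1 2 by (auto simp: ac_simps)
qed

subsection \<open>Lower bound on an optimal curve\<close>

lemma cum_at_0: "cum h 0 = 0"
proof -
  have "cum h 0 = (\<integral>s. h 0 * indicator {0::real} s \<partial>lborel)"
    unfolding cum_def set_lebesgue_integral_def
    by (rule Bochner_Integration.integral_cong[OF refl]) (auto simp: indicator_def)
  then show ?thesis by simp
qed

text \<open>A version of the fundamental theorem for \<open>- exp (- cum \<phi>)\<close> with a constant lost, so that \<open>\<phi>\<close> need not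
  be continuous: on intervals where \<open>cum \<phi>\<close> varies by at most 1, \<open>1 - exp (- a) \<ge> a / 2\<close> suffices.\<close>

lemma one_minus_exp_cum_ge:
  fixes \<phi> :: "real \<Rightarrow> real"
  assumes [measurable]: "\<phi> \<in> borel_measurable borel" and int: "set_integrable lborel {0..u} \<phi>"
    and bd: "\<And>s. 0 \<le> s \<Longrightarrow> s \<le> u \<Longrightarrow> 0 \<le> \<phi> s \<and> \<phi> s \<le> B" and "0 \<le> u"
  shows "set_integrable lborel {0..u} (\<lambda>s. \<phi> s * exp (- cum \<phi> s))"
    and "cum (\<lambda>s. \<phi> s * exp (- cum \<phi> s)) u / 2 \<le> 1 - exp (- cum \<phi> u)"
proof -
  define k where "k s = \<phi> s * exp (- cum \<phi> s)" for s
  have step: "0 \<le> (LINT x:{s<..t}|lborel. \<phi> x)" "(LINT x:{s<..t}|lborel. \<phi> x) \<le> B * (t - s)"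
    "cum \<phi> t = cum \<phi> s + (LINT x:{s<..t}|lborel. \<phi> x)" if "0 \<le> s" "s \<le> t" "t \<le> u" for s t
  proof -
    have it: "set_integrable lborel {0..t} \<phi>" using int that by (auto intro: set_integrable_subset)
    note sp = cum_split[OF it that(1,2)]
    show "cum \<phi> t = cum \<phi> s + (LINT x:{s<..t}|lborel. \<phi> x)" by (rule sp)
    show "0 \<le> (LINT x:{s<..t}|lborel. \<phi> x)"
      unfolding set_lebesgue_integral_def using bd that
      by (intro Bochner_Integration.integral_nonneg) (auto simp: indicator_def)
    have "(LINT x:{s<..t}|lborel. \<phi> x) \<le> (LINT x:{s<..t}|lborel. B)"
      using bd that sp(2) by (intro set_integral_mono set_integrable_lborel_const) auto
    then show "(LINT x:{s<..t}|lborel. \<phi> x) \<le> B * (t - s)"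
      using that by (simp add: set_integral_Ioc_const)
  qed
  have nn: "0 \<le> cum \<phi> s" if "0 \<le> s" "s \<le> u" for s
    using step[of 0 s] that by (simp add: cum_at_0)
  show ik: "set_integrable lborel {0..u} k"
    unfolding set_integrable_def
  proof (rule Bochner_Integration.integrable_bound)
    show "integrable lborel (\<lambda>s. indicator {0..u} s *\<^sub>R \<phi> s)" using int by (simp add: set_integrable_def)
    show "AE s in lborel. norm (indicator {0..u} s *\<^sub>R k s) \<le> norm (indicator {0..u} s *\<^sub>R \<phi> s)"
    proof (rule AE_I2)
      fix s
      show "norm (indicator {0..u} s *\<^sub>R k s) \<le> norm (indicator {0..u} s *\<^sub>R \<phi> s)"
        using bd[of s] nn[of s] by (auto simp: k_def indicator_def abs_mult intro!: mult_left_le)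
    qed
  qed (unfold k_def, measurable)
  \<comment> \<open>The excess to be shown nonnegative at \<open>u\<close>: it vanishes at 0 and
    does not decrease along a step on which \<phi> integrates to at most 1.\<close>
  define D where "D t = 1 - exp (- cum \<phi> t) - cum k t / 2" for t
  have D_step: "D s \<le> D t" if st: "0 \<le> s" "s \<le> t" "t \<le> u" and small: "B * (t - s) \<le> 1" for s t
  proof -
    define a where "a = (LINT x:{s<..t}|lborel. \<phi> x)"
    have a: "0 \<le> a" "a \<le> 1" "cum \<phi> t = cum \<phi> s + a" using step[OF st] small by (auto simp: a_def)
    have it: "set_integrable lborel {0..t} k" "set_integrable lborel {0..t} \<phi>"
      using ik int st by (auto intro: set_integrable_subset)
    have "(LINT x:{s<..t}|lborel. k x) \<le> (LINT x:{s<..t}|lborel. exp (- cum \<phi> s) * \<phi> x)"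
    proof (rule set_integral_mono)
      show "k x \<le> exp (- cum \<phi> s) * \<phi> x" if x: "x \<in> {s<..t}" for x
      proof -
        have "cum \<phi> s \<le> cum \<phi> x" using step[of s x] st x by auto
        then show ?thesis using bd[of x] st x by (auto simp: k_def mult.commute intro!: mult_left_mono)
      qed
    qed (use cum_split(2)[OF it(1) st(1,2)] cum_split(2)[OF it(2) st(1,2)] in auto)
    then have "cum k t - cum k s \<le> exp (- cum \<phi> s) * a"
      using cum_split(1)[OF it(1) st(1,2)] by (simp add: a_def)
    moreover have "a / 2 \<le> 1 - exp (- a)"
    proof -
      have "(1 + a) * exp (- a) \<le> exp a * exp (- a)"
        by (intro mult_right_mono) (auto simp: exp_ge_add_one_self)
      then have "exp (- a) \<le> 1 / (1 + a)"
        using a by (simp add: field_simps exp_minus)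
      \<comment> \<open>After clearing denominators this is a^2 \<le> a, the point where a \<le> 1
        is needed.\<close>
      also have "\<dots> \<le> 1 - a / 2"
        using a mult_left_mono[OF a(2) a(1)] by (simp add: field_simps)
      finally show ?thesis by simp
    qed
    then have "exp (- cum \<phi> s) * (a / 2) \<le> exp (- cum \<phi> s) * (1 - exp (- a))"
      by (intro mult_left_mono) auto
    moreover have "exp (- (cum \<phi> s + a)) = exp (- cum \<phi> s) * exp (- a)"
      by (simp add: mult_exp_exp)
    ultimately show ?thesis
      unfolding D_def a(3) by (simp only: right_diff_distrib mult_1_right times_divide_eq_right)
  qed
  \<comment> \<open>The number of steps is chosen so that the bound \<open>B\<close> makes \<phi>
    integrate to at most 1 over each of them.\<close>
  obtain n where n: "B * u \<le> real (Suc n)" using real_arch_simple[of "B * u"]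
    by (metis le_SucI of_nat_le_iff order_trans le_refl lessI less_imp_le)
  define r where "r = u / real (Suc n)"
  have r: "0 \<le> r" "real (Suc n) * r = u" "B * r \<le> 1"
    using n \<open>0 \<le> u\<close> by (auto simp: r_def field_simps)
  have "0 \<le> D (real i * r)" if "i \<le> Suc n" for i
    using that
  proof (induction i)
    case 0
    show ?case by (simp add: D_def cum_at_0)
  next
    case (Suc i)
    have "real (Suc i) * r \<le> real (Suc n) * r" using Suc.prems r by (intro mult_right_mono) auto
    then have "D (real i * r) \<le> D (real (Suc i) * r)"
      using r by (intro D_step) (auto simp: algebra_simps)
    then show ?case using Suc by simp
  qed
  from this[of "Suc n"] show "cum k u / 2 \<le> 1 - exp (- cum \<phi> u)"
    using r(2) by (simp add: D_def)
qed

text \<open>Fubini on the triangle s \<le> u < 1. A change of the curve at time s is felt at all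
  later times u, a set of length 1 - s; this weight decides both comparisons.\<close>

lemma nn_integral_swap_tail:
  fixes w :: "real \<Rightarrow> ennreal"
  assumes [measurable]: "w \<in> borel_measurable borel"
  shows "(\<integral>\<^sup>+u. (\<integral>\<^sup>+s. w s * indicator {0..u} s \<partial>lborel) * indicator {0..<1} u \<partial>lborel) =
    (\<integral>\<^sup>+s. w s * ennreal (1 - s) * indicator {0..<1} s \<partial>lborel)"
proof -
  have "(\<integral>\<^sup>+u. (\<integral>\<^sup>+s. w s * indicator {0..u} s \<partial>lborel) * indicator {0..<1} u \<partial>lborel) =
    (\<integral>\<^sup>+u. \<integral>\<^sup>+s. w s * indicator {q. 0 \<le> fst q \<and> fst q \<le> snd q \<and> snd q < 1} (s, u) \<partial>lborel \<partial>lborel)"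
    by (subst nn_integral_multc[symmetric])
       (auto intro!: nn_integral_cong simp: indicator_def)
  also have "\<dots> = (\<integral>\<^sup>+s. \<integral>\<^sup>+u. w s * indicator {q. 0 \<le> fst q \<and> fst q \<le> snd q \<and> snd q < 1} (s, u) \<partial>lborel \<partial>lborel)"
    by (rule lborel_pair.Fubini') measurable
  also have "\<dots> = (\<integral>\<^sup>+s. w s * ennreal (1 - s) * indicator {0..<1} s \<partial>lborel)"
  proof (rule nn_integral_cong)
    fix s :: real
    have "(\<integral>\<^sup>+u. w s * indicator {q. 0 \<le> fst q \<and> fst q \<le> snd q \<and> snd q < 1} (s, u) \<partial>lborel) =
      (\<integral>\<^sup>+u. (w s * indicator {0..<1} s) * indicator {s..<1} u \<partial>lborel)"
      by (intro nn_integral_cong) (auto simp: indicator_def)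
    also have "\<dots> = w s * ennreal (1 - s) * indicator {0..<1} s"
      by (subst nn_integral_cmult_indicator) (auto simp: indicator_def)
    finally show "(\<integral>\<^sup>+u. w s * indicator {q. 0 \<le> fst q \<and> fst q \<le> snd q \<and> snd q < 1} (s, u) \<partial>lborel) =
      w s * ennreal (1 - s) * indicator {0..<1} s" .
  qed
  finally show ?thesis .
qed

text \<open>Supplies the contradiction in both comparisons: by right-continuity, a violation at one
  time gives an interval on which the competitor differs from the optimal curve.\<close>

lemma nn_integral_pos_on_interval:
  fixes F :: "real \<Rightarrow> ennreal"
  assumes "F \<in> borel_measurable borel" "a < b" "\<And>s. a < s \<Longrightarrow> s < b \<Longrightarrow> 0 < F s"
  shows "(\<integral>\<^sup>+s. F s \<partial>lborel) \<noteq> 0"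
proof
  assume "(\<integral>\<^sup>+s. F s \<partial>lborel) = 0"
  then have "AE s in lborel. F s = 0" using assms(1) by (simp add: nn_integral_0_iff_AE)
  then have "AE s in lborel. s \<notin> {a<..<b}" by eventually_elim (use assms(3) in force)
  then have "{a<..<b} \<in> null_sets lborel" by (subst AE_iff_null_sets) auto
  then have "emeasure lborel {a<..<b} = 0" by (rule null_setsD1)
  then show False using assms(2) by simp
qed

section \<open>Modified threshold curves\<close>

lemma threshold_curve_borel_curve:
  "threshold_curve f \<Longrightarrow> f \<in> borel_measurable borel \<Longrightarrow> borel_curve f"
  by (simp add: borel_curve_def borel_curve_axioms_def threshold_curve_imp_curve)

text \<open>The raise includes the time \<open>t0\<close> itself, so a new jump there is compatible
  with right-continuity, while the left limit at \<open>t0\<close> is still that of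
  \<open>f\<close>.\<close>

lemma threshold_curve_raise:
  assumes f: "threshold_curve f" and "0 \<le> c"
  shows "threshold_curve (\<lambda>t. if t0 \<le> t then max (f t) c else f t)" (is "threshold_curve ?g")
  unfolding threshold_curve_def
proof (intro conjI ballI)
  interpret curve f using f by (rule threshold_curve_imp_curve)
  show "0 \<le> ?g t" if "t \<in> {0..<1}" for t using nonneg[of t] that by auto
  show "mono_on {0..<1} ?g"
    by (rule mono_onI) (auto intro: mono le_max_iff_disj[THEN iffD2] order_trans[OF mono])
  have ev: "eventually (\<lambda>s. ?g s = max (f s) c) F" if "eventually (\<lambda>s. t0 \<le> s) F" for F
    using that by eventually_elim simp
  have ev': "eventually (\<lambda>s. ?g s = f s) F" if "eventually (\<lambda>s. s < t0) F" for F
    using that by eventually_elim simp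
  show "(?g \<longlongrightarrow> ?g t) (at_right t)" if t: "t \<in> {0..<1}" for t
  proof -
    have lim: "(f \<longlongrightarrow> f t) (at_right t)" using f t by (simp add: threshold_curve_def)
    show ?thesis
    proof (cases "t0 \<le> t")
      case True
      then have "eventually (\<lambda>s. t0 \<le> s) (at_right t)"
        by (auto simp: eventually_at_filter)
      moreover have "((\<lambda>s. max (f s) c) \<longlongrightarrow> max (f t) c) (at_right t)" by (intro tendsto_intros lim)
      ultimately show ?thesis using True tendsto_cong[OF ev] by simp
    next
      case False
      then have "eventually (\<lambda>s. s < t0) (at_right t)"
        by (intro order_tendstoD(2)[OF tendsto_ident_at]) simp
      then show ?thesis using False lim tendsto_cong[OF ev'] by simp
    qed
  qed
  show "\<exists>l. (?g \<longlongrightarrow> l) (at_left t)" if t: "t \<in> {0<..<1}" for t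
  proof -
    have "\<forall>t\<in>{0<..<1}. \<exists>l. (f \<longlongrightarrow> l) (at_left t)" using f by (simp add: threshold_curve_def)
    from bspec[OF this t] obtain l where lim: "(f \<longlongrightarrow> l) (at_left t)" by blast
    show ?thesis
    proof (cases "t0 < t")
      case True
      then have "eventually (\<lambda>s. t0 < s) (at_left t)"
        by (intro order_tendstoD(1)[OF tendsto_ident_at])
      then have "eventually (\<lambda>s. t0 \<le> s) (at_left t)"
        by eventually_elim simp
      moreover have "((\<lambda>s. max (f s) c) \<longlongrightarrow> max l c) (at_left t)" by (intro tendsto_intros lim)
      ultimately show ?thesis using tendsto_cong[OF ev] by blast
    next
      case False
      then have "eventually (\<lambda>s. s < t0) (at_left t)"
        by (auto simp: eventually_at_filter)
      then show ?thesis using lim tendsto_cong[OF ev'] by blast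
    qed
  qed
qed

lemma threshold_curve_min:
  assumes f: "threshold_curve f" and h: "threshold_curve h"
  shows "threshold_curve (\<lambda>t. min (f t) (h t))"
  unfolding threshold_curve_def
proof (intro conjI ballI)
  interpret f: curve f using f by (rule threshold_curve_imp_curve)
  interpret h: curve h using h by (rule threshold_curve_imp_curve)
  show "0 \<le> min (f t) (h t)" if "t \<in> {0..<1}" for t using f.nonneg[of t] h.nonneg[of t] that by auto
  show "mono_on {0..<1} (\<lambda>t. min (f t) (h t))"
    by (rule mono_onI, rule min.mono) (auto intro: f.mono h.mono)
  show "((\<lambda>t. min (f t) (h t)) \<longlongrightarrow> min (f t) (h t)) (at_right t)" if "t \<in> {0..<1}" for t
    using f h that by (intro tendsto_intros) (auto simp: threshold_curve_def)
  show "\<exists>l. ((\<lambda>t. min (f t) (h t)) \<longlongrightarrow> l) (at_left t)" if "t \<in> {0<..<1}" for t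
  proof -
    have *: "\<forall>t\<in>{0<..<1}. \<exists>l. (f \<longlongrightarrow> l) (at_left t)" "\<forall>t\<in>{0<..<1}. \<exists>l. (h \<longlongrightarrow> l) (at_left t)"
      using f h by (simp_all add: threshold_curve_def)
    from *[THEN bspec, OF that] obtain l m where "(f \<longlongrightarrow> l) (at_left t)" "(h \<longlongrightarrow> m) (at_left t)"
      by blast
    then show ?thesis by (blast intro: tendsto_min)
  qed
qed

text \<open>This is 1 - exp (- y) \<le> y with y = b - a. The exponent a is relaxed to a smaller c,
  which in the application is the integral of the curve alone.\<close>

lemma exp_neg_diff_le:
  fixes a b c d :: real
  assumes "a \<le> b" "b - a \<le> d" "c \<le> a"
  shows "exp (- a) - exp (- b) \<le> exp (- c) * d"
proof -
  have "exp (- a) - exp (- b) = exp (- a) * (1 - exp (- (b - a)))"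
    by (simp add: exp_diff exp_minus field_simps exp_add)
  also have "1 - exp (- (b - a)) \<le> b - a"
    using exp_ge_add_one_self[of "- (b - a)"] by linarith
  then have "exp (- a) * (1 - exp (- (b - a))) \<le> exp (- a) * (b - a)"
    by (intro mult_left_mono) auto
  also have "\<dots> \<le> exp (- c) * d" using assms by (intro mult_mono) auto
  finally show ?thesis .
qed

text \<open>Let X be the integral of (g - f) exp (- F), where g is the raised curve and F the
  integral of f. The raise wins at least e^(-c) X at atoms of the new layer and costs at most c (1 -
  t0) X below f. Optimality bounds the former by the latter, and the assumption on c makes c (1 -
  t0) at most half of e^(-c). This forces X = 0, whereas f t0 < c would make X positive.\<close>

lemma (in unit_rate_poisson_process) optimal_lower_bound:
  assumes f: "threshold_curve f" and fm: "f \<in> borel_measurable borel"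
    and opt: "\<And>g. threshold_curve g \<Longrightarrow> success_prob M N g \<le> success_prob M N f"
    and t0: "0 \<le> t0" "t0 < 1" and c: "0 < c" "c * exp c * (1 - t0) \<le> 1 / 2"
  shows "c \<le> f t0"
proof (rule ccontr)
  assume "\<not> c \<le> f t0"
  define g where "g t = (if t0 \<le> t then max (f t) c else f t)" for t
  note fm[measurable]
  have gm[measurable]: "g \<in> borel_measurable borel" unfolding g_def by measurable
  have g: "threshold_curve g" unfolding g_def using threshold_curve_raise[OF f] c by simp
  interpret f: borel_curve f using f fm by (rule threshold_curve_borel_curve)
  interpret g: borel_curve g using g gm by (rule threshold_curve_borel_curve)
  have fg: "f t \<le> g t" "g t \<le> f t + c" if "0 \<le> t" "t < 1" for t
    using c f.nonneg[OF that] by (auto simp: g_def)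
  define loss where "loss = (\<integral>\<^sup>+t. \<integral>\<^sup>+x. ennreal (g.win_density t x) * indicator {f t<..g t} x * indicator {0..<1} t \<partial>lborel \<partial>lborel)"
  define gain where "gain = (\<integral>\<^sup>+t. \<integral>\<^sup>+x. ennreal (f.win_density t x - g.win_density t x) * indicator {0..f t} x * indicator {0..<1} t \<partial>lborel \<partial>lborel)"
  \<comment> \<open>Here the competitor is the higher curve, so \<open>loss\<close> is what raising
    the curve wins and \<open>gain\<close> is what it costs.\<close>
  have "ennreal (success_prob M N g) + gain = ennreal (success_prob M N f) + loss"
    unfolding gain_def loss_def
    by (rule exchange(1)) (use fg f.borel_curve_axioms g.borel_curve_axioms in auto)
  moreover have "ennreal (success_prob M N g) \<le> ennreal (success_prob M N f)"
    using opt[OF g] by (rule ennreal_leI)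
  ultimately have "ennreal (success_prob M N f) + loss \<le> ennreal (success_prob M N f) + gain"
    by (metis add_right_mono)
  then have loss_gain: "loss \<le> gain" by (simp add: ennreal_add_left_cancel_le)
  define w where "w s = ennreal ((g s - f s) * exp (- cum f s))" for s
  have wm[measurable]: "w \<in> borel_measurable borel" unfolding w_def by measurable
  define X where "X = (\<integral>\<^sup>+s. w s * indicator {0..<1} s \<partial>lborel)"
  have "ennreal (exp (- c)) * X = (\<integral>\<^sup>+t. \<integral>\<^sup>+x. ennreal (exp (- (cum f t + c))) * indicator {f t<..g t} x * indicator {0..<1} t \<partial>lborel \<partial>lborel)"
  proof -
    have "(\<integral>\<^sup>+x. ennreal (exp (- (cum f t + c))) * indicator {f t<..g t} x * indicator {0..<1} t \<partial>lborel) =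
      ennreal (exp (- c)) * (w t * indicator {0..<1} t)" for t
    proof (cases "t \<in> {0..<1}")
      case True
      have "exp (- (cum f t + c)) * (g t - f t) = exp (- c) * ((g t - f t) * exp (- cum f t))"
        by (simp add: exp_diff exp_minus exp_add field_simps)
      then show ?thesis using True fg[of t]
        by (simp add: nn_integral_cmult_indicator w_def ennreal_mult'[symmetric] ennreal_mult''[symmetric])
    qed simp
    then show ?thesis unfolding X_def by (simp add: nn_integral_cmult)
  qed
  also have "\<dots> \<le> loss"
    unfolding loss_def
  proof (intro nn_integral_mono)
    fix t x
    show "ennreal (exp (- (cum f t + c))) * indicator {f t<..g t} x * indicator {0..<1} t
      \<le> ennreal (g.win_density t x) * indicator {f t<..g t} x * indicator {0..<1} t"
    proof (cases "t \<in> {0..<1} \<and> x \<in> {f t<..g t}")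
      case True
      then have t: "0 \<le> t" "t < 1" and x: "f t < x" "x \<le> g t" by auto
      \<comment> \<open>The layer is nonempty only where f < c, and there g = c.\<close>
      have x': "0 \<le> x" "x \<le> c" using x f.nonneg[OF t] by (auto simp: g_def split: if_splits)
      have "max (g s) x \<le> f s + c" if "0 \<le> s" "s \<le> t" for s
        using fg(2)[of s] f.nonneg[of s] x' t that by auto
      then have "cum (\<lambda>s. max (g s) x) t \<le> cum (\<lambda>s. f s + c) t"
        using t
        by (intro cum_mono_on borel_curve.integrable_upto[OF g.curve_max] set_integral_add(1) f.integrable_upto set_integrable_lborel_const) auto
      also have "\<dots> = cum f t + c * t"
        using t by (simp add: cum_add f.integrable_upto set_integrable_lborel_const cum_const)
      \<comment> \<open>Before t the height grows by at most c, and after t it is at most c, so the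
        area exceeds the integral of f by at most c in total.\<close>
      finally have "cum (\<lambda>s. max (g s) x) t + (1 - t) * x \<le> cum f t + c * t + (1 - t) * c"
        using x' t by (intro add_mono mult_left_mono) auto
      then have "exp (- (cum f t + c)) \<le> g.win_density t x"
        unfolding g.win_density_def by (simp add: algebra_simps)
      then show ?thesis using True by (simp add: ennreal_leI)
    qed auto
  qed
  also note loss_gain
  \<comment> \<open>Only scores up to c feel the raise, hence the interval \<open>{0..c}\<close> in
    place of \<open>{0..f u}\<close>.\<close>
  also have "gain \<le> (\<integral>\<^sup>+u. \<integral>\<^sup>+x. ennreal (exp (- cum f u) * cum (\<lambda>s. g s - f s) u) * indicator {0..c} x * indicator {0..<1} u \<partial>lborel \<partial>lborel)"
    unfolding gain_def
  proof (intro nn_integral_mono)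
    fix u x
    show "ennreal (f.win_density u x - g.win_density u x) * indicator {0..f u} x * indicator {0..<1} u
      \<le> ennreal (exp (- cum f u) * cum (\<lambda>s. g s - f s) u) * indicator {0..c} x * indicator {0..<1} u"
    proof (cases "u \<in> {0..<1} \<and> x \<in> {0..f u}")
      case True
      then have u: "0 \<le> u" "u < 1" and x: "0 \<le> x" by auto
      show ?thesis
      proof (cases "x \<le> c")
        case xc: True
        have i: "set_integrable lborel {0..u} (\<lambda>s. max (f s) x)" "set_integrable lborel {0..u} (\<lambda>s. max (g s) x)"
          using u by (auto intro!: borel_curve.integrable_upto f.curve_max g.curve_max)
        have "f.win_density u x - g.win_density u x \<le> exp (- cum f u) * cum (\<lambda>s. g s - f s) u"
          unfolding f.win_density_def g.win_density_def
        proof (rule exp_neg_diff_le)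
          show "cum (\<lambda>s. max (f s) x) u + (1 - u) * x \<le> cum (\<lambda>s. max (g s) x) u + (1 - u) * x"
            using fg u i by (auto intro!: cum_mono_on intro: max.mono)
          have "max (g s) x - max (f s) x \<le> g s - f s" if "0 \<le> s" "s \<le> u" for s
            using fg(1)[of s] u that by auto
          then have "cum (\<lambda>s. max (g s) x - max (f s) x) u \<le> cum (\<lambda>s. g s - f s) u"
            using u i
            by (intro cum_mono_on set_integral_diff(1) f.integrable_upto g.integrable_upto) auto
          then show "cum (\<lambda>s. max (g s) x) u + (1 - u) * x - (cum (\<lambda>s. max (f s) x) u + (1 - u) * x) \<le> cum (\<lambda>s. g s - f s) u"
            using cum_diff[OF i(2,1)] by simp
          have "cum f u \<le> cum (\<lambda>s. max (f s) x) u"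
            using u i by (intro cum_mono_on f.integrable_upto) auto
          then show "cum f u \<le> cum (\<lambda>s. max (f s) x) u + (1 - u) * x"
            using u x by (simp add: add_increasing2)
        qed
        then show ?thesis using True xc by (simp add: ennreal_leI)
      next
        case False
        then have "max (g s) x = max (f s) x" for s by (auto simp: g_def)
        then show ?thesis using False by (simp add: f.win_density_def g.win_density_def)
      qed
    qed auto
  qed
  also have "\<dots> = (\<integral>\<^sup>+u. ennreal c * (ennreal (exp (- cum f u) * cum (\<lambda>s. g s - f s) u) * indicator {0..<1} u) \<partial>lborel)"
  proof (rule nn_integral_cong)
    fix u
    show "(\<integral>\<^sup>+x. ennreal (exp (- cum f u) * cum (\<lambda>s. g s - f s) u) * indicator {0..c} x * indicator {0..<1} u \<partial>lborel) =
      ennreal c * (ennreal (exp (- cum f u) * cum (\<lambda>s. g s - f s) u) * indicator {0..<1} u)"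
      using c by (cases "u \<in> {0..<1}") (simp_all add: nn_integral_cmult_indicator, rule mult.commute)
  qed
  also have "\<dots> \<le> (\<integral>\<^sup>+u. ennreal c * ((\<integral>\<^sup>+s. w s * indicator {0..u} s \<partial>lborel) * indicator {0..<1} u) \<partial>lborel)"
  proof (intro nn_integral_mono mult_left_mono)
    fix u
    show "ennreal (exp (- cum f u) * cum (\<lambda>s. g s - f s) u) * indicator {0..<1} u \<le>
      (\<integral>\<^sup>+s. w s * indicator {0..u} s \<partial>lborel) * indicator {0..<1} u"
    proof (cases "u \<in> {0..<1}")
      case True
      have "ennreal (exp (- cum f u) * cum (\<lambda>s. g s - f s) u) =
        ennreal (exp (- cum f u)) * (\<integral>\<^sup>+s. ennreal (g s - f s) * indicator {0..u} s \<partial>lborel)"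
        using True fg
        by (subst ennreal_mult', simp, subst ennreal_cum)
           (auto intro!: set_integral_diff(1) f.integrable_upto g.integrable_upto)
      also have "\<dots> = (\<integral>\<^sup>+s. ennreal (exp (- cum f u)) * (ennreal (g s - f s) * indicator {0..u} s) \<partial>lborel)"
        by (rule nn_integral_cmult[symmetric]) measurable
      also have "\<dots> \<le> (\<integral>\<^sup>+s. w s * indicator {0..u} s \<partial>lborel)"
      proof (intro nn_integral_mono)
        fix s
        show "ennreal (exp (- cum f u)) * (ennreal (g s - f s) * indicator {0..u} s) \<le> w s * indicator {0..u} s"
        proof (cases "s \<in> {0..u}")
          case s: True
          \<comment> \<open>Going back from u to s \<le> u only increases the exponential and
            produces the same weight \<open>w s\<close> as in \<open>X\<close>.\<close>
          have "exp (- cum f u) * (g s - f s) \<le> exp (- cum f s) * (g s - f s)"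
            using True s fg f.cum_mono[of s u] by (intro mult_right_mono) auto
          then have "ennreal (exp (- cum f u) * (g s - f s)) \<le> w s"
            unfolding w_def by (simp add: mult.commute ennreal_leI)
          then show ?thesis using s by (simp add: ennreal_mult')
        qed simp
      qed
      finally show ?thesis using True by simp
    qed simp
  qed simp
  also have "\<dots> = ennreal c * (\<integral>\<^sup>+s. w s * ennreal (1 - s) * indicator {0..<1} s \<partial>lborel)"
  proof -
    have "(\<integral>\<^sup>+u. ennreal c * ((\<integral>\<^sup>+s. w s * indicator {0..u} s \<partial>lborel) * indicator {0..<1} u) \<partial>lborel) =
      (\<integral>\<^sup>+u. (\<integral>\<^sup>+s. (ennreal c * w s) * indicator {0..u} s \<partial>lborel) * indicator {0..<1} u \<partial>lborel)"
      by (simp add: mult.assoc nn_integral_cmult)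
    also have "\<dots> = (\<integral>\<^sup>+s. (ennreal c * w s) * ennreal (1 - s) * indicator {0..<1} s \<partial>lborel)"
      by (rule nn_integral_swap_tail) measurable
    also have "\<dots> = ennreal c * (\<integral>\<^sup>+s. w s * ennreal (1 - s) * indicator {0..<1} s \<partial>lborel)"
      by (simp add: mult.assoc nn_integral_cmult)
    finally show ?thesis .
  qed
  \<comment> \<open>\<open>w\<close> vanishes before \<open>t0\<close>, so 1 - s may be replaced by
    1 - t0.\<close>
  also have "\<dots> \<le> ennreal c * (\<integral>\<^sup>+s. ennreal (1 - t0) * (w s * indicator {0..<1} s) \<partial>lborel)"
  proof (intro mult_left_mono nn_integral_mono)
    fix s
    show "w s * ennreal (1 - s) * indicator {0..<1} s \<le> ennreal (1 - t0) * (w s * indicator {0..<1} s)"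
    proof (cases "t0 \<le> s")
      case True
      then have "w s * ennreal (1 - s) \<le> w s * ennreal (1 - t0)" by (intro mult_left_mono ennreal_leI) auto
      then show ?thesis by (auto simp: indicator_def mult.commute)
    next
      case False
      then show ?thesis by (simp add: w_def g_def)
    qed
  qed simp
  also have "\<dots> = ennreal (c * (1 - t0)) * X"
    unfolding X_def using c t0 by (subst nn_integral_cmult) (auto simp: ennreal_mult mult.assoc)
  finally have main: "ennreal (exp (- c)) * X \<le> ennreal (c * (1 - t0)) * X" .
  \<comment> \<open>\<open>X\<close> has to be finite before it can be cancelled; the layer has
    height at most c.\<close>
  have "X \<le> (\<integral>\<^sup>+s. ennreal c * indicator {0..<1::real} s \<partial>lborel)"
    unfolding X_def
  proof (intro nn_integral_mono)
    fix s
    show "w s * indicator {0..<1} s \<le> ennreal c * indicator {0..<1} s"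
    proof (cases "s \<in> {0..<1}")
      case True
      then have "(g s - f s) * exp (- cum f s) \<le> c * 1"
        using fg[of s] f.cum_nonneg[of s] c by (intro mult_mono) auto
      then show ?thesis using True by (simp add: w_def ennreal_leI)
    qed simp
  qed
  then have "X < \<infinity>"
    by (simp add: nn_integral_cmult_indicator) (metis ennreal_less_top le_less_trans)
  then obtain r where r: "X = ennreal r" "0 \<le> r" by (cases X) auto
  have "exp (- c) * r \<le> c * (1 - t0) * r"
    using main r c t0 by (simp add: ennreal_mult'[symmetric])
  also have "\<dots> \<le> exp (- c) / 2 * r"
  proof (intro mult_right_mono r)
    have "c * (1 - t0) = (c * exp c * (1 - t0)) * exp (- c)" by (simp add: exp_minus)
    also have "\<dots> \<le> 1 / 2 * exp (- c)" using c by (intro mult_right_mono) auto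
    finally show "c * (1 - t0) \<le> exp (- c) / 2" by simp
  qed
  finally have "r \<le> 0" by (simp add: mult_le_0_iff field_simps) (use exp_gt_zero[of "- c"] in linarith)?
  then have "X = 0" using r by simp
  moreover have "X \<noteq> 0"
  proof -
    have "(f \<longlongrightarrow> f t0) (at_right t0)" using f t0 by (simp add: threshold_curve_def)
    then have "eventually (\<lambda>s. f s < c) (at_right t0)"
      using \<open>\<not> c \<le> f t0\<close> by (intro order_tendstoD) auto
    then obtain b where b: "t0 < b" "\<And>s. t0 < s \<Longrightarrow> s < b \<Longrightarrow> f s < c"
      by (auto simp: eventually_at_right_field)
    show ?thesis
      unfolding X_def
    proof (rule nn_integral_pos_on_interval[where a = t0 and b = "min b 1"])
      show "0 < w s * indicator {0..<1} s" if "t0 < s" "s < min b 1" for s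
        using b(2)[of s] that t0 by (auto simp: w_def g_def max_def)
    qed (use b t0 in auto)
  qed
  ultimately show False by blast
qed

subsection \<open>Upper bound on an optimal curve\<close>

lemma threshold_curve_log:
  assumes "0 \<le> a" "0 \<le> K"
  shows "threshold_curve (\<lambda>t. a * (- ln (1 - t)) + K)"
  unfolding threshold_curve_def
proof (intro conjI ballI)
  show "0 \<le> a * (- ln (1 - t)) + K" if "t \<in> {0..<1}" for t
    using that assms by (intro add_nonneg_nonneg mult_nonneg_nonneg) auto
  show "mono_on {0..<1} (\<lambda>t. a * (- ln (1 - t)) + K)"
    using assms by (intro mono_onI add_right_mono mult_left_mono) auto
  show "((\<lambda>t. a * (- ln (1 - t)) + K) \<longlongrightarrow> a * (- ln (1 - t)) + K) (at_right t)" if "t \<in> {0..<1}" for t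
    using that by (intro tendsto_intros) auto
  show "\<exists>l. ((\<lambda>t. a * (- ln (1 - t)) + K) \<longlongrightarrow> l) (at_left t)" if "t \<in> {0<..<1}" for t
    using that by (intro exI[of _ "a * (- ln (1 - t)) + K"] tendsto_intros) auto
qed

lemma borel_curve_log: "0 \<le> a \<Longrightarrow> 0 \<le> K \<Longrightarrow> borel_curve (\<lambda>t. a * (- ln (1 - t)) + K)"
  by (intro threshold_curve_borel_curve threshold_curve_log) measurable

text \<open>The primitive t + (1 - t) ln (1 - t) of - ln (1 - t) vanishes at 0 and stays below 1,
  although the curve itself is unbounded near 1.\<close>

lemma cum_log_le:
  assumes "0 \<le> u" "u < 1"
  shows "cum (\<lambda>t. - ln (1 - t)) u \<le> 1"
proof -
  have "((\<lambda>t. - ln (1 - t)) has_integral (u + (1 - u) * ln (1 - u)) - (0 + (1 - 0) * ln (1 - 0))) {0..u}"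
  proof (rule fundamental_theorem_of_calculus)
    fix t assume "t \<in> {0..u}"
    then have "1 - t > 0" using assms by auto
    then have "((\<lambda>t. t + (1 - t) * ln (1 - t)) has_real_derivative - ln (1 - t)) (at t within {0..u})"
      by (auto intro!: derivative_eq_intros)
    then show "((\<lambda>t. t + (1 - t) * ln (1 - t)) has_vector_derivative - ln (1 - t)) (at t within {0..u})"
      by (simp add: has_real_derivative_iff_has_vector_derivative)
  qed fact
  then have I: "((\<lambda>t. - ln (1 - t)) has_integral (u + (1 - u) * ln (1 - u))) {0..u}"
    by simp
  have "set_integrable lborel {0..u} (\<lambda>t. - ln (1 - t))"
    using borel_curve.integrable_upto[OF borel_curve_log[of 1 0] assms(2)] by simp
  then have "cum (\<lambda>t. - ln (1 - t)) u = integral {0..u} (\<lambda>t. - ln (1 - t))"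
    unfolding cum_def by (rule set_borel_integral_eq_integral)
  also have "\<dots> = u + (1 - u) * ln (1 - u)" using I by (rule integral_unique)
  also have "\<dots> \<le> u + (1 - u) * 0" using assms by (intro add_left_mono mult_left_mono) auto
  finally show ?thesis using assms by simp
qed

text \<open>Let \<phi> be what the cap h removes from f, let F be the integral of f, and let Y be
  the integral of \<phi>(s) exp (- F(s)) (1 - s). The cap costs at most \<kappa>/4 times Y and gains
  at least \<kappa>/2 times Y. The bound f T \<le> K keeps the cap inactive up to T; scores up to b
  remain below the capped curve after T; and the inequality with K / 2 is what remains when the two
  exponential rates are compared.\<close>

lemma (in unit_rate_poisson_process) optimal_upper_bound:
  assumes f: "threshold_curve f" and fm: "f \<in> borel_measurable borel"
    and opt: "\<And>g. threshold_curve g \<Longrightarrow> success_prob M N g \<le> success_prob M N f"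
    and T: "3 / 4 \<le> T" "T < 1" and \<delta>: "0 < \<delta>" "1 \<le> (1 + \<delta>) * T"
    and b: "0 < b" "b \<le> f T" 
    and K: "f T \<le> K" "f T + b + (1 + \<delta>) + ln 4 - ln b \<le> K / 2"
    and t: "0 \<le> t" "t < 1"
  shows "f t \<le> (1 + \<delta>) * (- ln (1 - t)) + K"
proof (rule ccontr)
  define h where "h t = (1 + \<delta>) * (- ln (1 - t)) + K" for t
  assume "\<not> f t \<le> (1 + \<delta>) * (- ln (1 - t)) + K"
  then have ht: "h t < f t" by (simp add: h_def)
  define g where "g t = min (f t) (h t)" for t
  note fm[measurable]
  have K0: "0 \<le> K" using b K by linarith
  have hm[measurable]: "h \<in> borel_measurable borel" unfolding h_def by measurable
  have gm[measurable]: "g \<in> borel_measurable borel" unfolding g_def by measurable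
  have h: "threshold_curve h" unfolding h_def using \<delta> K0 by (intro threshold_curve_log) auto
  have g: "threshold_curve g" unfolding g_def by (rule threshold_curve_min[OF f h])
  interpret f: borel_curve f using f fm by (rule threshold_curve_borel_curve)
  interpret g: borel_curve g using g gm by (rule threshold_curve_borel_curve)
  interpret h: borel_curve h using h hm by (rule threshold_curve_borel_curve)
  interpret L: borel_curve "\<lambda>t. - ln (1 - t)" using borel_curve_log[of 1 0] by simp
  have hK: "K \<le> h s" if "0 \<le> s" "s < 1" for s
  proof -
    have "0 \<le> (1 + \<delta>) * (- ln (1 - s))"
      using that \<delta> by (intro mult_nonneg_nonneg) auto
    then show ?thesis unfolding h_def by linarith
  qed
  have gf: "g s \<le> f s" "g s \<le> h s" for s by (auto simp: g_def)
  have g_eq: "g s = f s" if "0 \<le> s" "s \<le> T" for s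
    using f.mono[of s T] hK[of s] that T K by (auto simp: g_def)
  define \<phi> where "\<phi> s = f s - g s" for s
  have \<phi>m[measurable]: "\<phi> \<in> borel_measurable borel" unfolding \<phi>_def by measurable
  have \<phi>0: "0 \<le> \<phi> s" for s using gf by (simp add: \<phi>_def)
  have \<phi>i: "set_integrable lborel {0..u} \<phi>" if "u < 1" for u
    unfolding \<phi>_def using that by (intro set_integral_diff(1) f.integrable_upto g.integrable_upto)
  have cum_\<phi>: "cum \<phi> u = cum f u - cum g u" if "u < 1" for u
    unfolding \<phi>_def using that by (intro cum_diff f.integrable_upto g.integrable_upto)
  \<comment> \<open>Bounds the area below the capped curve after \<open>T\<close>, uniformly in the
    final time: the logarithm contributes at most 1 + \<delta> and the constant at most K (1 -
    T).\<close>
  define H where "H = (1 + \<delta>) + K * (1 - T)"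
  have G_le: "cum g u - cum g s \<le> H" if "T \<le> s" "s \<le> u" "u < 1" for s u
  proof -
    have s: "0 \<le> s" using that T by simp
    have "cum g u - cum g s = (LINT x:{s<..u}|lborel. g x)"
      using cum_split(1)[OF g.integrable_upto[OF that(3)] s that(2)] by simp
    also have "\<dots> \<le> (LINT x:{s<..u}|lborel. h x)"
      using gf by (intro set_integral_mono cum_split(2)[OF g.integrable_upto[OF that(3)] s that(2)]
        cum_split(2)[OF h.integrable_upto[OF that(3)] s that(2)])
    also have "\<dots> = cum h u - cum h s"
      using cum_split(1)[OF h.integrable_upto[OF that(3)] s that(2)] by simp
    also have "\<dots> = (1 + \<delta>) * (cum (\<lambda>t. - ln (1 - t)) u - cum (\<lambda>t. - ln (1 - t)) s) + K * (u - s)"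
    proof -
      have "cum h v = (1 + \<delta>) * cum (\<lambda>t. - ln (1 - t)) v + K * v" if "0 \<le> v" "v < 1" for v
      proof -
        have "cum h v = cum (\<lambda>t. (1 + \<delta>) * (- ln (1 - t))) v + cum (\<lambda>t. K) v"
          unfolding h_def using that L.integrable_upto[OF that(2)]
          by (intro cum_add set_integrable_mult_right set_integrable_lborel_const) auto
        also have "cum (\<lambda>t. (1 + \<delta>) * (- ln (1 - t))) v = (1 + \<delta>) * cum (\<lambda>t. - ln (1 - t)) v"
          unfolding cum_def by (rule set_integral_mult_right)
        finally show ?thesis using that by (simp add: cum_const)
      qed
      from this[of u] this[of s] show ?thesis using that s by (simp add: algebra_simps)
    qed
    also have "\<dots> \<le> (1 + \<delta>) * 1 + K * (1 - T)"
      using cum_log_le[of u] L.cum_nonneg[of s] that T \<delta> K0 s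
      by (intro add_mono mult_left_mono) auto
    finally show ?thesis by (simp add: H_def)
  qed
  define loss where "loss = (\<integral>\<^sup>+t. \<integral>\<^sup>+x. ennreal (f.win_density t x) * indicator {g t<..f t} x * indicator {0..<1} t \<partial>lborel \<partial>lborel)"
  define gain where "gain = (\<integral>\<^sup>+t. \<integral>\<^sup>+x. ennreal (g.win_density t x - f.win_density t x) * indicator {0..g t} x * indicator {0..<1} t \<partial>lborel \<partial>lborel)"
  have "ennreal (success_prob M N f) + gain = ennreal (success_prob M N g) + loss"
    and gain_le: "gain \<le> ennreal (success_prob M N g)"
    unfolding gain_def loss_def
    using exchange[OF g.borel_curve_axioms f.borel_curve_axioms gf(1)] by simp_all
  moreover have "ennreal (success_prob M N g) \<le> ennreal (success_prob M N f)"
    using opt[OF g] by (rule ennreal_leI)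
  ultimately have "ennreal (success_prob M N f) + gain \<le> ennreal (success_prob M N f) + loss"
    by (metis add_right_mono)
  then have gain_loss: "gain \<le> loss" by (simp add: ennreal_add_left_cancel_le)
  \<comment> \<open>Kept for the finiteness of \<open>Y\<close>, a multiple of which will be bounded
    by \<open>gain\<close>.\<close>
  have "gain < \<infinity>" using le_less_trans[OF gain_le ennreal_less_top] by simp
  define w where "w s = ennreal (\<phi> s * exp (- cum f s))" for s
  have wm[measurable]: "w \<in> borel_measurable borel" unfolding w_def by measurable
  define Y where "Y = (\<integral>\<^sup>+s. w s * ennreal (1 - s) * indicator {0..<1} s \<partial>lborel)"
  \<comment> \<open>The factors stem from the lower bound on \<open>gain\<close>: b is the length of
    the range of scores used, e^(-b) the price of blocking up to such a score, and e^(-H) that of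
    continuing from s to u below the capped curve.\<close>
  define \<kappa> where "\<kappa> = b * exp (- b - H)"
  have \<kappa>: "0 < \<kappa>" using b by (simp add: \<kappa>_def)
  have const: "exp (- (T * (h s - f T))) \<le> \<kappa> / 4 * (1 - s)" if "T \<le> s" "s < 1" for s
  proof -
    \<comment> \<open>The coefficient of the logarithm is still at least 1 after multiplication by
      T, so the logarithm alone yields a full factor 1 - s.\<close>
    have "1 * (- ln (1 - s)) \<le> ((1 + \<delta>) * T) * (- ln (1 - s))"
      using \<delta> that T by (intro mult_right_mono) auto
    then have 1: "- ln (1 - s) + T * K \<le> T * h s"
      by (simp add: h_def algebra_simps)
    \<comment> \<open>Subtracting from K T the term K (1 - T) contained in \<open>H\<close> leaves K
      (2 T - 1), which is at least K / 2 because T \<ge> 3/4.\<close>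
    have "K * (1 / 2) \<le> K * (2 * T - 1)" using K0 T by (intro mult_left_mono) auto
    moreover have "T * f T \<le> 1 * f T" using T b by (intro mult_right_mono) auto
    ultimately have 2: "- (T * K) + T * f T \<le> ln b - b - H - ln 4"
      using K(2) by (simp add: H_def algebra_simps)
    have "- (T * (h s - f T)) \<le> (ln b - b - H - ln 4) + ln (1 - s)"
      using 1 2 by (simp add: algebra_simps)
    then have "exp (- (T * (h s - f T))) \<le> exp ((ln b - b - H - ln 4) + ln (1 - s))" by simp
    also have "\<dots> = \<kappa> / 4 * (1 - s)"
      using b that by (simp add: \<kappa>_def exp_add exp_diff exp_minus field_simps)
    finally show ?thesis .
  qed
  \<comment> \<open>An atom above h wins only if [0,T] is free of scores below it, whereas f
    accounts for an area of at most T f(T) there; the excess over F is at least T (h - f T), as used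
    in \<open>const\<close>.\<close>
  have "loss \<le> (\<integral>\<^sup>+t. \<integral>\<^sup>+x. ennreal (\<kappa> / 4 * (exp (- cum f t) * (1 - t))) * indicator {g t<..f t} x * indicator {0..<1} t \<partial>lborel \<partial>lborel)"
    unfolding loss_def
  proof (intro nn_integral_mono)
    fix t x
    show "ennreal (f.win_density t x) * indicator {g t<..f t} x * indicator {0..<1} t
      \<le> ennreal (\<kappa> / 4 * (exp (- cum f t) * (1 - t))) * indicator {g t<..f t} x * indicator {0..<1} t"
    proof (cases "t \<in> {0..<1} \<and> x \<in> {g t<..f t}")
      case True
      then have t: "0 \<le> t" "t < 1" and x: "h t < x" "x \<le> f t" by (auto simp: g_def)
      have tT: "T < t" using True g_eq[of t] by force
      have x0: "0 \<le> x" using x h.nonneg[OF t] by simp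
      interpret mx: borel_curve "\<lambda>s. max (f s) x" by (rule f.curve_max)
      have T0: "0 \<le> T" using T by simp
      have "x * T = cum (\<lambda>s. x) T" using T by (simp add: cum_const)
      also have "\<dots> \<le> cum (\<lambda>s. max (f s) x) T"
        using T by (intro cum_mono_on mx.integrable_upto set_integrable_lborel_const) auto
      finally have 1: "x * T \<le> cum (\<lambda>s. max (f s) x) T" .
      have 2: "(LINT s:{T<..t}|lborel. f s) \<le> (LINT s:{T<..t}|lborel. max (f s) x)"
        using cum_split(2)[OF f.integrable_upto[OF t(2)] T0] cum_split(2)[OF mx.integrable_upto[OF t(2)] T0] tT
        by (intro set_integral_mono) auto
      have "cum f T \<le> cum (\<lambda>s. f T) T"
        using T by (intro cum_mono_on f.integrable_upto set_integrable_lborel_const) (auto intro: f.mono)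
      then have 3: "cum f T \<le> f T * T" using T by (simp add: cum_const)
      have "h t * T \<le> x * T" using x T by (intro mult_right_mono) auto
      then have "cum f t + T * (h t - f T) \<le> cum (\<lambda>s. max (f s) x) t"
        using cum_split(1)[OF f.integrable_upto[OF t(2)] T0] cum_split(1)[OF mx.integrable_upto[OF t(2)] T0] tT 1 2 3
        by (simp add: algebra_simps)
      moreover have "0 \<le> (1 - t) * x" using t x0 by simp
      ultimately have "f.win_density t x \<le> exp (- cum f t) * exp (- (T * (h t - f T)))"
        unfolding f.win_density_def mult_exp_exp by simp
      also have "\<dots> \<le> exp (- cum f t) * (\<kappa> / 4 * (1 - t))"
        using const[of t] tT t by (intro mult_left_mono) auto
      finally have "f.win_density t x \<le> \<kappa> / 4 * (exp (- cum f t) * (1 - t))" by (simp add: mult_ac)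
      then show ?thesis using True by (simp add: ennreal_leI)
    qed auto
  qed
  also have "\<dots> = (\<integral>\<^sup>+t. ennreal (\<kappa> / 4) * (w t * ennreal (1 - t) * indicator {0..<1} t) \<partial>lborel)"
  proof (rule nn_integral_cong)
    fix t
    show "(\<integral>\<^sup>+x. ennreal (\<kappa> / 4 * (exp (- cum f t) * (1 - t))) * indicator {g t<..f t} x * indicator {0..<1} t \<partial>lborel) =
      ennreal (\<kappa> / 4) * (w t * ennreal (1 - t) * indicator {0..<1} t)"
    proof (cases "t \<in> {0..<1}")
      case True
      have "\<kappa> / 4 * (exp (- cum f t) * (1 - t)) * \<phi> t = \<kappa> / 4 * (\<phi> t * exp (- cum f t) * (1 - t))"
        by (simp add: mult_ac)
      then show ?thesis using True gf[of t] \<phi>0[of t] \<kappa>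
        by (simp add: nn_integral_cmult_indicator w_def ennreal_mult''[symmetric] ennreal_mult'[symmetric] flip: \<phi>_def)
    qed simp
  qed
  also have "\<dots> = ennreal (\<kappa> / 4) * Y"
    unfolding Y_def by (rule nn_integral_cmult) measurable
  finally have loss_le: "loss \<le> ennreal (\<kappa> / 4) * Y" .
  \<comment> \<open>Read backwards, the exchange of integrals restores the time u of a later atom, a
    share 1 - exp (- cum \<phi> u) of whose winning probability is due to the cap.\<close>
  have "ennreal (\<kappa> / 2) * Y = (\<integral>\<^sup>+u. (\<integral>\<^sup>+s. (ennreal (\<kappa> / 2) * w s) * indicator {0..u} s \<partial>lborel) * indicator {0..<1} u \<partial>lborel)"
    unfolding Y_def by (subst nn_integral_swap_tail) (simp_all add: mult.assoc nn_integral_cmult)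
  also have "\<dots> \<le> (\<integral>\<^sup>+u. \<integral>\<^sup>+x. ennreal (exp (- b) * exp (- cum g u) * (1 - exp (- cum \<phi> u))) * indicator {0..b} x * indicator {0..<1} u \<partial>lborel \<partial>lborel)"
  proof (rule nn_integral_mono)
    fix u
    show "(\<integral>\<^sup>+s. (ennreal (\<kappa> / 2) * w s) * indicator {0..u} s \<partial>lborel) * indicator {0..<1} u \<le>
      (\<integral>\<^sup>+x. ennreal (exp (- b) * exp (- cum g u) * (1 - exp (- cum \<phi> u))) * indicator {0..b} x * indicator {0..<1} u \<partial>lborel)"
    proof (cases "u \<in> {0..<1}")
      case True
      then have u: "0 \<le> u" "u < 1" by auto
      define k where "k s = \<phi> s * exp (- cum \<phi> s)" for s
      have bd: "0 \<le> \<phi> s \<and> \<phi> s \<le> f u" if "0 \<le> s" "s \<le> u" for s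
        using \<phi>0[of s] f.mono[of s u] g.nonneg[of s] that u by (auto simp: \<phi>_def)
      have ki: "set_integrable lborel {0..u} k"
        and half: "cum k u / 2 \<le> 1 - exp (- cum \<phi> u)"
        unfolding k_def using one_minus_exp_cum_ge[OF \<phi>m \<phi>i[OF u(2)] bd u(1)] by auto
      have km[measurable]: "k \<in> borel_measurable borel" unfolding k_def by measurable
      have k0: "0 \<le> k s" for s using \<phi>0 by (simp add: k_def)
      have "(\<integral>\<^sup>+s. (ennreal (\<kappa> / 2) * w s) * indicator {0..u} s \<partial>lborel) \<le>
        (\<integral>\<^sup>+s. ennreal (b * exp (- b) * exp (- cum g u) / 2) * (ennreal (k s) * indicator {0..u} s) \<partial>lborel)"
      proof (rule nn_integral_mono)
        fix s
        show "(ennreal (\<kappa> / 2) * w s) * indicator {0..u} s \<le>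
          ennreal (b * exp (- b) * exp (- cum g u) / 2) * (ennreal (k s) * indicator {0..u} s)"
        proof (cases "s \<in> {0..u} \<and> \<phi> s \<noteq> 0")
          case s: True
          then have sT: "T \<le> s" using g_eq[of s] by (force simp: \<phi>_def)
          \<comment> \<open>F(s) splits into the integrals of g and \<phi> up to s. Extending that
            of g to u adds at most \<open>H\<close>, because s lies beyond T whenever \<phi>(s) is
            nonzero.\<close>
          have "exp (- H) * exp (- cum f s) = exp (- H - cum g s) * exp (- cum \<phi> s)"
            using s u by (simp add: cum_\<phi> mult_exp_exp)
          also have "\<dots> \<le> exp (- cum g u) * exp (- cum \<phi> s)"
            using G_le[OF sT _ u(2)] s by (intro mult_right_mono) auto
          finally have "(b * exp (- b) / 2 * \<phi> s) * (exp (- H) * exp (- cum f s)) \<le>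
            (b * exp (- b) / 2 * \<phi> s) * (exp (- cum g u) * exp (- cum \<phi> s))"
            using b \<phi>0[of s] by (intro mult_left_mono) auto
          moreover have "exp (- b - H) = exp (- b) * exp (- H)" by (simp add: mult_exp_exp)
          ultimately have "\<kappa> / 2 * (\<phi> s * exp (- cum f s)) \<le> b * exp (- b) * exp (- cum g u) / 2 * k s"
            by (simp add: \<kappa>_def k_def mult_ac)
          then have "ennreal (\<kappa> / 2 * (\<phi> s * exp (- cum f s))) \<le> ennreal (b * exp (- b) * exp (- cum g u) / 2 * k s)"
            by (rule ennreal_leI)
          then show ?thesis using s \<kappa> b
            by (simp add: w_def ennreal_mult'[symmetric])
        qed (auto simp: w_def)
      qed
      also have "\<dots> = ennreal (b * exp (- b) * exp (- cum g u) / 2) * ennreal (cum k u)"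
        using ki k0 by (subst nn_integral_cmult) (auto simp: ennreal_cum)
      also have "\<dots> = ennreal (b * exp (- b) * exp (- cum g u) * (cum k u / 2))"
        using b by (subst ennreal_mult'[symmetric]) (simp_all add: mult_ac)
      also have "\<dots> \<le> ennreal (b * exp (- b) * exp (- cum g u) * (1 - exp (- cum \<phi> u)))"
        using half b by (intro ennreal_leI mult_left_mono) auto
      also have "\<dots> = ennreal (exp (- b) * exp (- cum g u) * (1 - exp (- cum \<phi> u))) * ennreal b"
        using b by (subst ennreal_mult''[symmetric]) (simp_all add: mult_ac)
      also have "\<dots> = (\<integral>\<^sup>+x. ennreal (exp (- b) * exp (- cum g u) * (1 - exp (- cum \<phi> u))) * indicator {0..b} x \<partial>lborel)"
        using b by (simp add: nn_integral_cmult_indicator)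
      finally show ?thesis using True by simp
    qed simp
  qed
  also have "\<dots> \<le> gain"
    unfolding gain_def
  proof (intro nn_integral_mono)
    fix u x
    show "ennreal (exp (- b) * exp (- cum g u) * (1 - exp (- cum \<phi> u))) * indicator {0..b} x * indicator {0..<1} u
      \<le> ennreal (g.win_density u x - f.win_density u x) * indicator {0..g u} x * indicator {0..<1} u"
    proof (cases "u \<in> {0..<1} \<and> x \<in> {0..b}")
      case True
      then have u: "0 \<le> u" "u < 1" and x: "0 \<le> x" "x \<le> b" by auto
      show ?thesis
      proof (cases "u \<le> T")
        case uT: True
        \<comment> \<open>Up to T the curves agree, so the left-hand side is 0.\<close>
        have "cum f u = cum g u" using g_eq uT by (intro cum_cong) auto
        then show ?thesis using u by (simp add: cum_\<phi>)
      next
        case False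
        have bK: "b \<le> K" using b K by linarith
        have "b \<le> g u" using b bK hK[OF u] f.mono[of T u] False T u by (auto simp: g_def)
        have i: "set_integrable lborel {0..u} (\<lambda>s. max (f s) x)" "set_integrable lborel {0..u} (\<lambda>s. max (g s) x)"
          using u by (auto intro!: borel_curve.integrable_upto f.curve_max g.curve_max)
        \<comment> \<open>Where the cap is active, both curves lie at or above K and hence at or
          above x, so the maxima differ by exactly \<phi>.\<close>
        have "max (f s) x - max (g s) x = \<phi> s" if "0 \<le> s" "s \<le> u" for s
          using hK[of s] bK x u that by (auto simp: \<phi>_def g_def)
        then have "cum (\<lambda>s. max (f s) x - max (g s) x) u = cum \<phi> u" by (rule cum_cong)
        then have c: "cum (\<lambda>s. max (f s) x) u = cum (\<lambda>s. max (g s) x) u + cum \<phi> u"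
          using cum_diff[OF i] by simp
        have diff: "g.win_density u x - f.win_density u x = g.win_density u x * (1 - exp (- cum \<phi> u))"
          unfolding g.win_density_def f.win_density_def c right_diff_distrib mult_exp_exp by simp
        have "max (g s) x \<le> g s + x" if "0 \<le> s" "s \<le> u" for s
          using g.nonneg[of s] that u x by auto
        then have "cum (\<lambda>s. max (g s) x) u \<le> cum (\<lambda>s. g s + x) u"
          using u i by (intro cum_mono_on set_integral_add(1) g.integrable_upto set_integrable_lborel_const) auto
        also have "\<dots> = cum g u + x * u"
          using u by (simp add: cum_add g.integrable_upto set_integrable_lborel_const cum_const)
        finally have "cum (\<lambda>s. max (g s) x) u + (1 - u) * x \<le> b + cum g u"
          using x by (simp add: algebra_simps)
        then have "exp (- b) * exp (- cum g u) \<le> g.win_density u x"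
          unfolding g.win_density_def mult_exp_exp by simp
        moreover have "0 \<le> cum \<phi> u"
          unfolding cum_def set_lebesgue_integral_def using \<phi>0
          by (intro Bochner_Integration.integral_nonneg) (auto simp: indicator_def)
        ultimately have "exp (- b) * exp (- cum g u) * (1 - exp (- cum \<phi> u)) \<le> g.win_density u x - f.win_density u x"
          unfolding diff by (intro mult_right_mono) auto
        then show ?thesis using True \<open>b \<le> g u\<close> by (simp add: ennreal_leI)
      qed
    qed auto
  qed
  finally have gain_ge: "ennreal (\<kappa> / 2) * Y \<le> gain" .
  then have "ennreal (\<kappa> / 2) * Y < \<infinity>" using \<open>gain < \<infinity>\<close> by (rule le_less_trans)
  then have "Y < \<infinity>" using \<kappa> by (auto simp: ennreal_mult_less_top)
  then obtain r where r: "Y = ennreal r" "0 \<le> r" by (cases Y) auto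
  have "ennreal (\<kappa> / 2) * Y \<le> ennreal (\<kappa> / 4) * Y"
    using gain_ge gain_loss loss_le by (blast intro: order_trans)
  then have "\<kappa> / 2 * r \<le> \<kappa> / 4 * r"
    using r \<kappa> by (simp add: ennreal_mult'[symmetric])
  then have "Y = 0" using r \<kappa> by (simp add: mult_le_0_iff field_simps)
  moreover have "Y \<noteq> 0"
  proof -
    have "(f \<longlongrightarrow> f t) (at_right t)" "(h \<longlongrightarrow> h t) (at_right t)" using f h t by (simp_all add: threshold_curve_def)
    then have "((\<lambda>s. f s - h s) \<longlongrightarrow> f t - h t) (at_right t)" by (intro tendsto_intros)
    then have "eventually (\<lambda>s. 0 < f s - h s) (at_right t)"
      using ht by (intro order_tendstoD) auto
    then obtain c where c: "t < c" "\<And>s. t < s \<Longrightarrow> s < c \<Longrightarrow> h s < f s"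
      by (auto simp: eventually_at_right_field)
    show ?thesis
      unfolding Y_def
    proof (rule nn_integral_pos_on_interval[where a = t and b = "min c 1"])
      show "0 < w s * ennreal (1 - s) * indicator {0..<1} s" if "t < s" "s < min c 1" for s
        using c(2)[of s] that t by (auto simp: w_def \<phi>_def g_def ennreal_zero_less_mult_iff)
    qed (use c t in auto)
  qed
  ultimately show False by blast
qed

subsection \<open>Asymptotics\<close>

text \<open>Carries bounds up to each u < 1, where the curve is integrable by monotonicity, over to
  the whole interval.\<close>

lemma nn_integral_Ico_le:
  fixes w :: "real \<Rightarrow> ennreal"
  assumes [measurable]: "w \<in> borel_measurable borel"
    and le: "\<And>u. 0 \<le> u \<Longrightarrow> u < 1 \<Longrightarrow> (\<integral>\<^sup>+s. w s * indicator {0..u} s \<partial>lborel) \<le> C"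
  shows "(\<integral>\<^sup>+s. w s * indicator {0..<1} s \<partial>lborel) \<le> C"
proof -
  define r where "r n = 1 - 1 / real (Suc n)" for n
  have r: "0 \<le> r n" "r n < 1" "r n \<le> r (Suc n)" for n
    by (auto simp: r_def field_simps)
  have "(\<integral>\<^sup>+s. w s * indicator {0..<1} s \<partial>lborel) = (\<integral>\<^sup>+s. (\<Squnion>n. w s * indicator {0..r n} s) \<partial>lborel)"
  proof (rule nn_integral_cong)
    fix s :: real
    show "w s * indicator {0..<1} s = (\<Squnion>n. w s * indicator {0..r n} s)"
    proof (cases "s \<in> {0..<1}")
      case True
      then obtain n where "inverse (real (Suc n)) < 1 - s" using reals_Archimedean[of "1 - s"] by auto
      then have "s \<in> {0..r n}" using True by (simp add: r_def inverse_eq_divide)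
      then show ?thesis using True
        by (intro antisym SUP_least SUP_upper2[of n]) (auto simp: indicator_def)
    next
      case False
      then have "s \<notin> {0..r n}" for n using r(2)[of n] by auto
      then show ?thesis using False by simp
    qed
  qed
  also have "\<dots> = (\<Squnion>n. \<integral>\<^sup>+s. w s * indicator {0..r n} s \<partial>lborel)"
  proof (rule nn_integral_monotone_convergence_SUP)
    show "incseq (\<lambda>n s. w s * indicator {0..r n} s)"
    proof (intro incseq_SucI le_funI mult_left_mono)
      show "indicator {0..r n} s \<le> (indicator {0..r (Suc n)} s :: ennreal)" for n s
        using r(3)[of n] by (auto simp: indicator_def)
    qed simp
  qed measurable
  also have "\<dots> \<le> C" using r le by (intro SUP_least) auto
  finally show ?thesis .
qed

lemma emeasure_subgraph:
  assumes "borel_curve f"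
  shows "emeasure lborel (subgraph f) = cumulative f 1"
proof -
  interpret borel_curve f by fact
  have "emeasure lborel (subgraph f) = emeasure (lborel \<Otimes>\<^sub>M lborel) (subgraph f)"
    by (simp add: lborel_prod)
  also have "\<dots> = (\<integral>\<^sup>+t. emeasure lborel (Pair t -` subgraph f) \<partial>lborel)"
    by (intro lborel.emeasure_pair_measure_alt) (simp only: lborel_prod sets_lborel sets_subgraph)
  also have "\<dots> = cumulative f 1"
    unfolding cumulative_def
  proof (rule nn_integral_cong)
    fix t
    have "Pair t -` subgraph f = (if t \<in> {0..<1} then {0..f t} else {})"
      by (auto simp: subgraph_def)
    then show "emeasure lborel (Pair t -` subgraph f) = ennreal (f t) * indicator {0..<1} t"
      using nonneg[of t] by auto
  qed
  finally show ?thesis .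
qed

lemma neg_ln_at_top: "filterlim (\<lambda>t::real. - ln (1 - t)) at_top (at_left 1)"
  by real_asymp

text \<open>Write L for - ln (1 - t). The choice c = (1 - \<delta>) L turns c e^c (1 - t) into (1 -
  \<delta>) L e^(- \<delta> L), which tends to 0, so it is admissible near 1; in the upper bound K
  is absorbed by \<delta> L.\<close>

lemma asymp_equiv_neg_ln:
  fixes f :: "real \<Rightarrow> real"
  assumes lower: "\<And>t c. 0 \<le> t \<Longrightarrow> t < 1 \<Longrightarrow> 0 < c \<Longrightarrow> c * exp c * (1 - t) \<le> 1 / 2 \<Longrightarrow> c \<le> f t"
    and upper: "\<And>\<delta>. 0 < \<delta> \<Longrightarrow> \<exists>K. \<forall>t. 0 \<le> t \<longrightarrow> t < 1 \<longrightarrow> f t \<le> (1 + \<delta>) * (- ln (1 - t)) + K"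
  shows "f \<sim>[at_left 1] (\<lambda>t. - ln (1 - t))"
proof (rule asymp_equivI')
  let ?L = "\<lambda>t::real. - ln (1 - t)"
  show "((\<lambda>t. f t / ?L t) \<longlongrightarrow> 1) (at_left 1)"
  proof (rule tendstoI)
    fix e :: real assume "0 < e"
    \<comment> \<open>The ratio will lie between 1 - \<delta> and 1 + 2 \<delta>, so 2 \<delta> < e
      is wanted; the cap by 1 keeps 1 - \<delta> positive.\<close>
    define \<delta> where "\<delta> = min e 1 / 3"
    have \<delta>: "0 < \<delta>" "\<delta> < 1" "2 * \<delta> < e" using \<open>0 < e\<close> by (auto simp: \<delta>_def)
    obtain K where K: "\<And>t. 0 \<le> t \<Longrightarrow> t < 1 \<Longrightarrow> f t \<le> (1 + \<delta>) * ?L t + K" using upper[OF \<delta>(1)] by blast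
    have "((\<lambda>y::real. (1 - \<delta>) * y * exp (- \<delta> * y)) \<longlongrightarrow> 0) at_top"
      using \<delta>(1) by real_asymp
    then have "((\<lambda>t. (1 - \<delta>) * ?L t * exp (- \<delta> * ?L t)) \<longlongrightarrow> 0) (at_left 1)"
      by (rule filterlim_compose[OF _ neg_ln_at_top])
    then have "eventually (\<lambda>t. (1 - \<delta>) * ?L t * exp (- \<delta> * ?L t) < 1 / 2) (at_left 1)"
      by (rule order_tendstoD) simp
    moreover have "eventually (\<lambda>t. max 1 (K / \<delta>) \<le> ?L t) (at_left 1)"
      using neg_ln_at_top unfolding filterlim_at_top by blast
    moreover have "eventually (\<lambda>t::real. 0 < t) (at_left 1)"
      by (rule order_tendstoD(1)[OF tendsto_ident_at]) simp
    moreover have "eventually (\<lambda>t::real. t < 1) (at_left 1)"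
      by (simp add: eventually_at_filter)
    ultimately show "eventually (\<lambda>t. dist (f t / ?L t) 1 < e) (at_left 1)"
    proof eventually_elim
      case (elim t)
      then have t: "0 \<le> t" "t < 1" by auto
      have L: "1 \<le> ?L t" "K \<le> \<delta> * ?L t" using elim(2) \<delta>(1) by (auto simp: field_simps)
      have "(1 - \<delta>) * ?L t \<le> f t"
      proof (rule lower[OF t])
        show "0 < (1 - \<delta>) * ?L t" using \<delta> L by (intro mult_pos_pos) auto
        have "exp ((1 - \<delta>) * ?L t) * (1 - t) = exp ((1 - \<delta>) * ?L t) * exp (- ?L t)" using t by simp
        also have "\<dots> = exp (- \<delta> * ?L t)" unfolding mult_exp_exp by (simp add: algebra_simps)
        finally show "(1 - \<delta>) * ?L t * exp ((1 - \<delta>) * ?L t) * (1 - t) \<le> 1 / 2"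
          using elim(1) by (simp add: mult.assoc)
      qed
      moreover have "f t \<le> (1 + 2 * \<delta>) * ?L t" using K[OF t] L(2) by (simp add: algebra_simps)
      moreover have "0 < ?L t" using L(1) by linarith
      ultimately have "1 - \<delta> \<le> f t / ?L t" "f t / ?L t \<le> 1 + 2 * \<delta>"
        by (simp_all only: pos_le_divide_eq pos_divide_le_eq)
      then show ?case using \<delta> by (simp add: dist_real_def abs_less_iff)
    qed
  qed
qed

section \<open>Consequences for an optimal curve\<close>

context unit_rate_poisson_process
begin

text \<open>The supremum of reals is an upper bound because probabilities are bounded by 1.\<close>

lemma success_prob_le_optimal:
  assumes "optimal_threshold_curve M N f" "threshold_curve g"
  shows "success_prob M N g \<le> success_prob M N f"
proof -
  have "bdd_above (success_prob M N ` {g. threshold_curve g})"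
    by (rule bdd_aboveI[of _ 1]) (auto simp: success_prob_def)
  then show ?thesis
    using assms cSUP_upper[of g "{g. threshold_curve g}" "success_prob M N"]
    by (simp add: optimal_threshold_curve_def)
qed

lemma optimal_borel_curve_asymptotics:
  assumes f: "threshold_curve f" and fm: "f \<in> borel_measurable borel"
    and opt: "\<And>g. threshold_curve g \<Longrightarrow> success_prob M N g \<le> success_prob M N f"
  shows "f \<sim>[at_left 1] (\<lambda>t. - ln (1 - t))" "cumulative f 1 < \<infinity>"
    "prob {\<omega> \<in> space M. memoryless_time f (N \<omega>) = 1} = exp (- enn2real (cumulative f 1))"
proof -
  interpret borel_curve f using f fm by (rule threshold_curve_borel_curve)
  note lower = optimal_lower_bound[OF f fm opt]
  have upper: "\<exists>K\<ge>0. \<forall>t. 0 \<le> t \<longrightarrow> t < 1 \<longrightarrow> f t \<le> (1 + \<delta>) * (- ln (1 - t)) + K" if \<delta>: "0 < \<delta>" for \<delta>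
  proof -
    \<comment> \<open>At least 3/4 for the balance of the exponents, and at least 1 / (1 + \<delta>)
      for the factor 1 - s.\<close>
    define T where "T = max (3 / 4) (1 / (1 + \<delta>))"
    have T: "3 / 4 \<le> T" "T < 1" using \<delta> by (auto simp: T_def field_simps)
    have "(1 + \<delta>) * (1 / (1 + \<delta>)) \<le> (1 + \<delta>) * T" using \<delta> by (intro mult_left_mono) (auto simp: T_def)
    then have \<delta>T: "1 \<le> (1 + \<delta>) * T" using \<delta> by simp
    \<comment> \<open>The upper bound needs a positive b with b \<le> f T. The lower bound with c =
      1/4 at time 3/4 provides b = 1/4.\<close>
    have "exp (1 / 4) \<le> (exp 1 :: real)" by simp
    then have "exp (1 / 4) \<le> (3 :: real)" using exp_le by linarith
    then have "1 / 4 * exp (1 / 4) * (1 - 3 / 4) \<le> (1 / 2 :: real)" by simp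
    then have "1 / 4 \<le> f (3 / 4)" by (intro lower) auto
    then have b: "1 / 4 \<le> f T" using mono[of "3 / 4" T] T by simp
    define K where "K = max (f T) (2 * (f T + 1 / 4 + (1 + \<delta>) + ln 4 - ln (1 / 4)))"
    have "0 \<le> K" using b by (simp add: K_def)
    moreover have "f t \<le> (1 + \<delta>) * (- ln (1 - t)) + K" if "0 \<le> t" "t < 1" for t
      by (rule optimal_upper_bound[OF f fm opt T \<delta> \<delta>T _ b _ _ that]) (auto simp: K_def)
    ultimately show ?thesis by blast
  qed
  show "f \<sim>[at_left 1] (\<lambda>t. - ln (1 - t))"
    using lower upper by (intro asymp_equiv_neg_ln) blast+
  \<comment> \<open>For integrability one fixed \<delta> is enough; here \<delta> = 1.\<close>
  obtain K where K: "0 \<le> K" "\<And>t. 0 \<le> t \<Longrightarrow> t < 1 \<Longrightarrow> f t \<le> 2 * (- ln (1 - t)) + K"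
    using upper[of 1] by auto
  note borel[measurable]
  have L: "borel_curve (\<lambda>t. - ln (1 - t))" using borel_curve_log[of 1 0] by simp
  have "cum f u \<le> 2 + K" if u: "0 \<le> u" "u < 1" for u
  proof -
    note iL = borel_curve.integrable_upto[OF L u(2)]
    have "cum f u \<le> cum (\<lambda>t. 2 * (- ln (1 - t)) + K) u"
      using K u by (intro cum_mono_on integrable_upto borel_curve.integrable_upto[OF borel_curve_log]) auto
    also have "\<dots> = cum (\<lambda>t. 2 * (- ln (1 - t))) u + cum (\<lambda>t. K) u"
      by (intro cum_add set_integrable_mult_right set_integrable_lborel_const iL) auto
    also have "cum (\<lambda>t. 2 * (- ln (1 - t))) u = 2 * cum (\<lambda>t. - ln (1 - t)) u"
      unfolding cum_def by (rule set_integral_mult_right)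
    also have "2 * cum (\<lambda>t. - ln (1 - t)) u + cum (\<lambda>t. K) u \<le> 2 * 1 + K * 1"
      using u K(1) cum_log_le[OF u] unfolding cum_const[OF u(1)]
      by (intro add_mono mult_left_mono) auto
    finally show ?thesis by simp
  qed
  then have "cumulative f 1 \<le> ennreal (2 + K)"
    unfolding cumulative_def
    by (intro nn_integral_Ico_le) (auto simp: ennreal_cum[symmetric] integrable_upto nonneg ennreal_leI)
  then show fin: "cumulative f 1 < \<infinity>" using le_less_trans[OF _ ennreal_less_top] by simp
  show "prob {\<omega> \<in> space M. memoryless_time f (N \<omega>) = 1} = exp (- enn2real (cumulative f 1))"
    using prob_none[OF curve_axioms] fin
    by (simp add: emeasure_subgraph[OF borel_curve_axioms] measure_def)
qed

end

text \<open>Right limits on [0,1) and left limits on (0,1) see only values taken inside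
  [0,1).\<close>

lemma threshold_curve_cong:
  assumes "threshold_curve f" and eq: "\<And>t. 0 \<le> t \<Longrightarrow> t < 1 \<Longrightarrow> g t = f t"
  shows "threshold_curve g"
proof -
  have r: "(g \<longlongrightarrow> l) (at_right t) \<longleftrightarrow> (f \<longlongrightarrow> l) (at_right t)" if "t \<in> {0..<1}" for t l
  proof (rule tendsto_cong)
    have "eventually (\<lambda>s. s < 1) (at_right t)" using that by (intro order_tendstoD(2)[OF tendsto_ident_at]) auto
    moreover have "eventually (\<lambda>s. t < s) (at_right t)" by (simp add: eventually_at_filter)
    ultimately show "eventually (\<lambda>s. g s = f s) (at_right t)"
      by eventually_elim (use that eq in auto)
  qed
  have l: "(g \<longlongrightarrow> l) (at_left t) \<longleftrightarrow> (f \<longlongrightarrow> l) (at_left t)" if "t \<in> {0<..<1}" for t l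
  proof (rule tendsto_cong)
    have "eventually (\<lambda>s. 0 < s) (at_left t)" using that by (intro order_tendstoD(1)[OF tendsto_ident_at]) auto
    moreover have "eventually (\<lambda>s. s < t) (at_left t)" by (simp add: eventually_at_filter)
    ultimately show "eventually (\<lambda>s. g s = f s) (at_left t)"
      by eventually_elim (use that eq in auto)
  qed
  show ?thesis
    using assms(1) unfolding threshold_curve_def
    by (auto simp: eq r l mono_on_def)
qed

theorem theorem6:
  fixes M :: "'w measure" and N :: "'w \<Rightarrow> (real \<times> real) set" and f :: "real \<Rightarrow> real"
  assumes "unit_rate_poisson_process M N"
    and "optimal_threshold_curve M N f"
  shows "f \<sim>[at_left 1] (\<lambda>t. - ln (1 - t)) \<and>
    set_integrable lborel {0..<1} f \<and>
    cumulative f 1 < \<infinity> \<and>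
    measure M {\<omega> \<in> space M. memoryless_time f (N \<omega>) = 1} = exp (- enn2real (cumulative f 1)) \<and>
    measure M {\<omega> \<in> space M. memoryless_time f (N \<omega>) = 1} > 0"
proof -
  interpret unit_rate_poisson_process M N by fact
  \<comment> \<open>Outside [0,1) the curve is arbitrary and need not be Borel. Setting it to 0
    there keeps the subgraph, hence the stopping rule and optimality.\<close>
  define g where "g t = indicator {0..<1} t * f t" for t
  have f: "threshold_curve f" using assms(2) by (simp add: optimal_threshold_curve_def)
  interpret f: curve f using f by (rule threshold_curve_imp_curve)
  have gf: "g t = f t" if "0 \<le> t" "t < 1" for t using that by (simp add: g_def)
  have gm[measurable]: "g \<in> borel_measurable borel" unfolding g_def[abs_def] by (rule f.measurable_restrict)
  have g: "threshold_curve g" using f gf by (rule threshold_curve_cong)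
  have "subgraph g = subgraph f" by (auto simp: subgraph_def g_def)
  then have time: "memoryless_time g = memoryless_time f"
    by (simp add: memoryless_time_def memoryless_point_def fun_eq_iff)
  then have "success_prob M N g = success_prob M N f" by (simp add: success_prob_def)
  then have opt: "success_prob M N k \<le> success_prob M N g" if "threshold_curve k" for k
    using success_prob_le_optimal[OF assms(2) that] by simp
  have cum: "cumulative g 1 = cumulative f 1"
    unfolding cumulative_def by (intro nn_integral_cong) (auto simp: g_def indicator_def)
  note res = optimal_borel_curve_asymptotics[OF g gm opt, unfolded time cum]
  have "eventually (\<lambda>t. f t = g t) (at_left 1)"
  proof -
    have "eventually (\<lambda>s::real. 0 < s) (at_left 1)" by (rule order_tendstoD(1)[OF tendsto_ident_at]) simp
    moreover have "eventually (\<lambda>s::real. s < 1) (at_left 1)" by (simp add: eventually_at_filter)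
    ultimately show ?thesis by eventually_elim (simp add: gf)
  qed
  from asymp_equiv_cong[OF this always_eventually[OF allI[OF refl]]]
  have "f \<sim>[at_left 1] (\<lambda>t. - ln (1 - t))" using res(1) by blast
  moreover have "set_integrable lborel {0..<1} f"
    unfolding set_integrable_def
  proof (rule integrableI_nonneg)
    show "(\<lambda>s. indicator {0..<1} s *\<^sub>R f s) \<in> borel_measurable lborel"
      using f.measurable_restrict by simp
    show "AE s in lborel. 0 \<le> indicator {0..<1} s *\<^sub>R f s" using f.nonneg by (auto simp: indicator_def)
    have "(\<integral>\<^sup>+s. ennreal (indicator {0..<1} s *\<^sub>R f s) \<partial>lborel) = cumulative f 1"
      unfolding cumulative_def by (intro nn_integral_cong) (auto simp: indicator_def)
    then show "(\<integral>\<^sup>+s. ennreal (indicator {0..<1} s *\<^sub>R f s) \<partial>lborel) < \<infinity>" using res(2) by simp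
  qed
  ultimately show ?thesis using res(2,3) by simp
qed

end
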